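(* Let $d\geq 1$ be an integer, $\sigma>0$, and $0<\varepsilon_0\leq 4\exp(-e^{1+\sigma^{-2}})$. Define $y_0=\log(4/\varepsilon_0)$, $x_0=\dfrac{2y_0}{W\bigl(\frac{y_0}{e\sigma^2}\bigr)}$, and $$K_{d,\sigma,\varepsilon_0}=\binom{x_0+d}{d}\cdot\Bigl(\frac{\log(y_0)}{y_0}\Bigr)^d.$$ Then for all $0<\varepsilon\leq\varepsilon_0$ we have $$\mathcal{H}\bigl(\mathrm{Id}: H_\sigma(B_2^d)\to\ell_\infty(B_2^d),\,\varepsilon\bigr)\leq K_{d,\sigma,\varepsilon_0}\cdot\frac{\bigl(\log(4/\varepsilon)\bigr)^{d+1}}{\bigl(\log\log(4/\varepsilon)\bigr)^{d}}.$$
   Context: $B_2^d\subseteq\mathbb{R}^d$ denotes the closed Euclidean unit ball. For $\sigma>0$ and $X\subseteq\mathbb{R}^d$, $H_\sigma(X)$ is the reproducing kernel Hilbert space (of real-valued functions on $X$) of the isotropic Gaussian kernel $k_\sigma(x,x')=\exp(-\sigma^2\|x-x'\|_{\ell_2^d}^2)$, $x,x'\in X$, where $\|\cdot\|_{\ell_2^d}$ is the Euclidean norm. $\ell_\infty(X)$ is the Banach space of bounded functions $f:X\to\mathbb{R}$ with the supremum norm, and $\mathrm{Id}$ is the canonical embedding $f\mapsto f$. For a bounded subset $A$ of a Banach space $E$ with closed unit ball $B_E$, the covering numbers are $\mathcal{N}(A,\varepsilon)=\min\{n\in\{1,2,\ldots\}: \exists x_1,\ldots,x_n\in E \text{ with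 } A\subseteq\bigcup_{i=1}^n (x_i+\varepsilon B_E)\}$, $\varepsilon>0$. For a bounded linear operator $T:E\to F$ between Banach spaces, the log-covering numbers are $\mathcal{H}(T,\varepsilon)=\log\mathcal{N}(T B_E,\varepsilon)$, with $\log$ the natural logarithm. For real $t>0$ and integer $d\geq1$ the generalized binomial coefficient is $\binom{t+d}{d}=\frac{1}{d!}\prod_{i=1}^d(t+i)$. $W:[-1/e,\infty)\to[-1,\infty)$ is the upper (principal) branch of Lambert's $W$-function, i.e. the inverse of $t\mapsto te^t$ on $[-1,\infty)$. *)

theory Defs
  imports "HOL-Analysis.Analysis"
begin

text \<open>
  Real-valued functions on a set \<open>X\<close> are represented by total functions that vanish outside \<open>X\<close>,
  so that equality and the pointwise linear structure are those of functions on \<open>X\<close>.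
\<close>

definition zero_ext :: "'a set \<Rightarrow> ('a \<Rightarrow> real) \<Rightarrow> 'a \<Rightarrow> real" where
  "zero_ext X f = (\<lambda>x. if x \<in> X then f x else 0)"

definition ip_norm :: "(('a \<Rightarrow> real) \<Rightarrow> ('a \<Rightarrow> real) \<Rightarrow> real) \<Rightarrow> ('a \<Rightarrow> real) \<Rightarrow> real" where
  "ip_norm ip f = sqrt (ip f f)"

locale function_hilbert_space =
  fixes X :: "'a set"
    and H :: "('a \<Rightarrow> real) set"
    and ip :: "('a \<Rightarrow> real) \<Rightarrow> ('a \<Rightarrow> real) \<Rightarrow> real"
  assumes supported: "f \<in> H \<Longrightarrow> x \<notin> X \<Longrightarrow> f x = 0"
    and zero_mem: "(\<lambda>x. 0) \<in> H"
    and add_mem: "f \<in> H \<Longrightarrow> g \<in> H \<Longrightarrow> (\<lambda>x. f x + g x) \<in> H"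
    and scale_mem: "f \<in> H \<Longrightarrow> (\<lambda>x. c * f x) \<in> H"
    and ip_commute: "f \<in> H \<Longrightarrow> g \<in> H \<Longrightarrow> ip f g = ip g f"
    and ip_add_left: "f \<in> H \<Longrightarrow> g \<in> H \<Longrightarrow> h \<in> H \<Longrightarrow> ip (\<lambda>x. f x + g x) h = ip f h + ip g h"
    and ip_scale_left: "f \<in> H \<Longrightarrow> g \<in> H \<Longrightarrow> ip (\<lambda>x. c * f x) g = c * ip f g"
    and ip_nonneg: "f \<in> H \<Longrightarrow> ip f f \<ge> 0"
    and ip_definite: "f \<in> H \<Longrightarrow> ip f f = 0 \<Longrightarrow> f = (\<lambda>x. 0)"
    and complete:
      "(\<And>n. s n \<in> H) \<Longrightarrow>
       (\<And>e. e > 0 \<Longrightarrow> \<exists>N. \<forall>m\<ge>N. \<forall>n\<ge>N. ip_norm ip (\<lambda>x. s m x - s n x) < e) \<Longrightarrow>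
       \<exists>f\<in>H. (\<lambda>n. ip_norm ip (\<lambda>x. s n x - f x)) \<longlonglongrightarrow> 0"

text \<open>
  By the Moore--Aronszajn theorem, \<open>H\<close> and the restriction of \<open>ip\<close> to \<open>H\<close> are uniquely determined
  by \<open>X\<close> and \<open>k\<close>, and they exist whenever \<open>k\<close> is positive semidefinite on \<open>X\<close>.
\<close>

locale rkhs = function_hilbert_space X H ip
  for X :: "'a set" and k :: "'a \<Rightarrow> 'a \<Rightarrow> real"
    and H :: "('a \<Rightarrow> real) set" and ip :: "('a \<Rightarrow> real) \<Rightarrow> ('a \<Rightarrow> real) \<Rightarrow> real" +
  assumes kernel_mem: "x \<in> X \<Longrightarrow> zero_ext X (\<lambda>y. k y x) \<in> H"
    and reproducing: "f \<in> H \<Longrightarrow> x \<in> X \<Longrightarrow> ip f (zero_ext X (\<lambda>y. k y x)) = f x"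

definition gaussian_kernel :: "real \<Rightarrow> 'a::real_normed_vector \<Rightarrow> 'a \<Rightarrow> real" where
  "gaussian_kernel \<sigma> x y = exp (- (\<sigma>\<^sup>2 * (norm (x - y))\<^sup>2))"

definition ell_infty :: "'a set \<Rightarrow> ('a \<Rightarrow> real) set" where
  "ell_infty X = {f. bounded (f ` X) \<and> (\<forall>x. x \<notin> X \<longrightarrow> f x = 0)}"

text \<open>Only meaningful for nonempty \<open>X\<close>, since the supremum of the empty set of reals is arbitrary.\<close>

definition sup_norm :: "'a set \<Rightarrow> ('a \<Rightarrow> real) \<Rightarrow> real" where
  "sup_norm X f = (SUP x\<in>X. \<bar>f x\<bar>)"

definition unit_ball :: "('a \<Rightarrow> real) set \<Rightarrow> (('a \<Rightarrow> real) \<Rightarrow> real) \<Rightarrow> ('a \<Rightarrow> real) set" where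
  "unit_ball E nE = {f \<in> E. nE f \<le> 1}"

text \<open>
  Normed spaces of functions are given by a carrier and a norm. The value is \<open>\<infinity>\<close> if no finite
  cover exists, so an upper bound on a covering number includes finiteness.
\<close>

definition covering_number ::
    "('a \<Rightarrow> real) set \<Rightarrow> (('a \<Rightarrow> real) \<Rightarrow> real) \<Rightarrow> ('a \<Rightarrow> real) set \<Rightarrow> real \<Rightarrow> enat" where
  "covering_number E nE A \<epsilon> =
     Inf {enat n | n. n \<ge> 1 \<and> (\<exists>c. (\<forall>i\<in>{1..n}. c i \<in> E) \<and>
       A \<subseteq> (\<Union>i\<in>{1..n}. {(\<lambda>x. c i x + \<epsilon> * b x) | b. b \<in> unit_ball E nE}))}"

definition log_covering_number ::
    "('a \<Rightarrow> real) set \<Rightarrow> (('a \<Rightarrow> real) \<Rightarrow> real) \<Rightarrow> ('b \<Rightarrow> real) set \<Rightarrow> (('b \<Rightarrow> real) \<Rightarrow> real) \<Rightarrow>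
     (('a \<Rightarrow> real) \<Rightarrow> ('b \<Rightarrow> real)) \<Rightarrow> real \<Rightarrow> ereal" where
  "log_covering_number E nE F nF T \<epsilon> =
     (case covering_number F nF (T ` unit_ball E nE) \<epsilon> of
        enat n \<Rightarrow> ereal (ln (real n)) | \<infinity> \<Rightarrow> \<infinity>)"

definition gen_binomial :: "real \<Rightarrow> nat \<Rightarrow> real" where
  "gen_binomial t d = (1 / fact d) * (\<Prod>i=1..d. t + real i)"

text \<open>The value \<open>gen_binomial t d\<close> is the binomial coefficient of \<open>t + d\<close> over \<open>d\<close>.\<close>

lemma gen_binomial_eq_gchoose: "gen_binomial t d = (t + real d) gchoose d"
proof -
  have "(\<Prod>i=1..d. t + real i) = (\<Prod>i=0..<d. t + real d - real i)"
    by (rule prod.reindex_bij_witness[where i="\<lambda>i. d - i" and j="\<lambda>i. d - i"])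
       (auto simp: of_nat_diff)
  then show ?thesis
    by (simp add: gen_binomial_def gbinomial_prod_rev)
qed

text \<open>Principal branch of Lambert's function; the defining map is injective on \<open>[-1, \<infinity>)\<close>.\<close>

definition lambert_W :: "real \<Rightarrow> real" where
  "lambert_W = the_inv_into {-1..} (\<lambda>t. t * exp t)"

end

theory Submission imports Defs
begin

text \<open>
  The Gaussian kernel is the sum of a feature expansion indexed by multi-indices \<open>\<alpha>\<close>: expanding
  \<open>exp (2 \<sigma>\<^sup>2 (x \<bullet> y))\<close> with the multinomial theorem gives features
  \<open>\<Phi>\<^sub>\<alpha> x = exp (- \<sigma>\<^sup>2 |x|\<^sup>2) \<Prod>\<^sub>i sqrt ((2 \<sigma>\<^sup>2) ^ \<alpha>\<^sub>i / \<alpha>\<^sub>i!) x\<^sub>i ^ \<alpha>\<^sub>i\<close> with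
  \<open>k (x, y) = \<Sum>\<^sub>\<alpha> \<Phi>\<^sub>\<alpha> x \<Phi>\<^sub>\<alpha> y\<close>. An element of the unit ball of the Hilbert space is a combination of
  the features with a coefficient vector of Euclidean norm at most one. Only the features of degree
  at most \<open>n\<close> are kept. By the Cauchy--Schwarz inequality the error at \<open>x\<close> is at most
  the square root of the sum of \<open>(\<Phi>\<^sub>\<alpha> x)\<^sup>2\<close> over the omitted \<open>\<alpha>\<close>. That sum is a Poisson tail,
  on the unit ball at most \<open>(2 \<sigma>\<^sup>2)\<^sup>m / m!\<close> with \<open>m = n + 1\<close> (\<open>gaussian_feature_tail_le\<close>).

  There remain \<open>D = (n + d choose d)\<close> coefficients. Since \<open>\<Sum>\<^sub>\<alpha> (\<Phi>\<^sub>\<alpha> x)\<^sup>2 = k (x, x) = 1\<close>, the supremum norm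
  of a combination is at most the Euclidean norm of its coefficients, so a net of the Euclidean unit
  ball in dimension \<open>D\<close> yields a cover of the truncated functions. Comparing volumes gives a
  \<open>\<delta>\<close>-net with at most \<open>(1 + 2 / \<delta>)\<^sup>D\<close> points (\<open>unit_ball_finite_net\<close>). For \<open>\<delta> = 2 \<epsilon> / 3\<close> and
  \<open>\<epsilon> \<le> 1\<close> the base is at most \<open>4 / \<epsilon>\<close>, so the log-covering number is at most \<open>D y\<close> with
  \<open>y = ln (4 / \<epsilon>)\<close>.

  Lambert's function enters through the choice of \<open>n\<close>. With \<open>w exp w = y / (e \<sigma>\<^sup>2)\<close> and
  \<open>x = 2 y / w\<close> one has \<open>2 e \<sigma>\<^sup>2 / x = exp (- w)\<close>. For \<open>m \<ge> x\<close>, bounding \<open>m!\<close> below by \<open>(m / e)\<^sup>m\<close>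
  bounds the tail by \<open>exp (- w m) \<le> exp (- w x) = exp (- 2 y) = (\<epsilon> / 4)\<^sup>2\<close>
  (\<open>degree_cutoff_bound\<close>). Hence \<open>n = \<lfloor>x\<rfloor>\<close> will do, and \<open>D\<close> is at most the generalized binomial
  coefficient at \<open>x\<close>.

  Finally \<open>gen_binomial x d * (ln y / y) ^ d\<close> decreases as \<open>y\<close> grows (\<open>growth_factor_antimono\<close>), so
  that its value \<open>K\<close> at \<open>y\<^sub>0\<close> serves for all \<open>\<epsilon> \<le> \<epsilon>\<^sub>0\<close>. This is a product of the factors
  \<open>x ln y / y + i ln y / y\<close>, divided by \<open>d!\<close>. Here \<open>x ln y / y = 2 ln y / w\<close>, whose derivative in \<open>w\<close>
  has the sign of \<open>- ln (w \<sigma>\<^sup>2)\<close>; the bound on \<open>\<epsilon>\<^sub>0\<close> says exactly that \<open>w \<sigma>\<^sup>2 \<ge> 1\<close> at \<open>y\<^sub>0\<close>. It also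
  implies \<open>y\<^sub>0 \<ge> e\<close>, from where on \<open>ln y / y\<close> decreases.

  The coefficient vectors come from kernel interpolation instead of an orthonormal basis of the
  Hilbert space. A function \<open>f\<close> of norm at most one agrees on a finite set \<open>S\<close> with its orthogonal
  projection \<open>\<Sum>\<^sub>s c\<^sub>s k (\<cdot>, s)\<close> onto the kernel sections at \<open>S\<close>, whose coefficient at \<open>\<Phi>\<^sub>\<alpha>\<close> is the finite
  sum \<open>\<Sum>\<^sub>s c\<^sub>s \<Phi>\<^sub>\<alpha> s\<close>. Both functions are continuous with a modulus read off from the kernel, so for a
  fine net \<open>S\<close> of the ball they are uniformly close (\<open>uniform_approx_by_kernel_sections\<close>). The radius
  \<open>\<epsilon>\<close> is thus spent as \<open>\<epsilon> / 4\<close> for the tail, \<open>2 \<epsilon> / 3\<close> for the net and \<open>\<epsilon> / 12\<close> for the interpolation.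
\<close>

section \<open>Covering Euclidean balls\<close>

text \<open>
  The number of coefficients depends on \<open>\<epsilon>\<close>, so it cannot be the dimension of a fixed Euclidean type;
  \<open>\<real>\<^sup>I\<close> is modelled by the product measure over a finite set \<open>I\<close>. For balls around the origin the volume
  is \<open>emeasure_cball_aux\<close>, and the product measure inherits translation invariance from its factors.
\<close>
lemma emeasure_PiM_lborel_translated_ball:
  fixes p :: "'i \<Rightarrow> real"
  assumes I: "finite I" and r: "r > 0"
  defines "M \<equiv> Pi\<^sub>M I (\<lambda>_. lborel :: real measure)"
  shows "emeasure M {a \<in> space M. L2_set (\<lambda>i. a i - p i) I \<le> r}
    = ennreal (unit_ball_vol (card I) * r ^ card I)"
proof -
  interpret product_sigma_finite "\<lambda>_::'i. lborel :: real measure"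
    by standard
  define T where "T a = (\<lambda>i\<in>I. - p i + a i)" for a :: "'i \<Rightarrow> real"
  define S where "S = {a. sqrt (\<Sum>i\<in>I. (a i)\<^sup>2) \<le> r} \<inter> space M"
  have T[measurable]: "T \<in> measurable M M"
    unfolding T_def M_def by measurable
  have S[measurable]: "S \<in> sets M"
    unfolding S_def M_def by measurable
  have "distr M M T = M"
    unfolding M_def
  proof (rule PiM_eqI)
    fix A :: "'i \<Rightarrow> real set"
    assume A: "\<And>i. i \<in> I \<Longrightarrow> A i \<in> sets lborel"
    have [measurable]: "Pi\<^sub>E I A \<in> sets (Pi\<^sub>M I (\<lambda>_. lborel))"
      using I A by (intro sets_PiM_I_finite) auto
    have "T -` Pi\<^sub>E I A \<inter> space (Pi\<^sub>M I (\<lambda>_. lborel)) = (\<Pi>\<^sub>E i\<in>I. (+) (- p i) -` A i)"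
      by (auto simp: T_def space_PiM PiE_iff)
    then have "emeasure (distr (Pi\<^sub>M I (\<lambda>_. lborel)) (Pi\<^sub>M I (\<lambda>_. lborel)) T) (Pi\<^sub>E I A)
        = emeasure (Pi\<^sub>M I (\<lambda>_. lborel)) (\<Pi>\<^sub>E i\<in>I. (+) (- p i) -` A i)"
      using T by (subst emeasure_distr) (auto simp: M_def)
    also have "\<dots> = (\<Prod>i\<in>I. emeasure lborel ((+) (- p i) -` A i))"
    proof (intro emeasure_PiM I)
      fix i assume "i \<in> I"
      moreover have "(+) (- p i) \<in> measurable lborel lborel"
        by measurable
      ultimately show "(+) (- p i) -` A i \<in> sets lborel"
        using measurable_sets[of "(+) (- p i)" lborel lborel "A i"] A by simp
    qed
    also have "\<dots> = (\<Prod>i\<in>I. emeasure lborel (A i))"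
    proof (rule prod.cong)
      fix i assume "i \<in> I"
      then have "emeasure (distr lborel borel ((+) (- p i))) (A i)
          = emeasure lborel ((+) (- p i) -` A i)"
        using A by (subst emeasure_distr) auto
      then show "emeasure lborel ((+) (- p i) -` A i) = emeasure lborel (A i)"
        by (simp only: lborel_distr_plus)
    qed simp
    finally show "emeasure (distr (Pi\<^sub>M I (\<lambda>_. lborel)) (Pi\<^sub>M I (\<lambda>_. lborel)) T) (Pi\<^sub>E I A)
        = (\<Prod>i\<in>I. emeasure lborel (A i))" .
  qed (use I in auto)
  then have "emeasure M S = emeasure M (T -` S \<inter> space M)"
    using emeasure_distr[OF T S] by simp
  also have "T -` S \<inter> space M = {a \<in> space M. L2_set (\<lambda>i. a i - p i) I \<le> r}"
    using measurable_space[OF T] by (auto simp: S_def T_def L2_set_def)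
  finally show ?thesis
    using emeasure_cball_aux[OF I r] by (simp add: S_def M_def)
qed

text \<open>
  Volume comparison: the balls of radius \<open>\<delta> / 2\<close> around the points of \<open>P\<close> are disjoint and contained in
  the ball of radius \<open>1 + \<delta> / 2\<close> around the origin. Members of \<open>P\<close> are extensional because two functions
  that agree on \<open>I\<close> are the same point of \<open>\<real>\<^sup>I\<close>.
\<close>
lemma card_separated_unit_ball_le:
  fixes P :: "('i \<Rightarrow> real) set"
  assumes I: "finite I" and \<delta>: "\<delta> > 0" and P: "finite P" "P \<subseteq> extensional I"
    and ball: "\<And>p. p \<in> P \<Longrightarrow> L2_set p I \<le> 1"
    and sep: "\<And>p q. p \<in> P \<Longrightarrow> q \<in> P \<Longrightarrow> p \<noteq> q \<Longrightarrow> \<delta> < L2_set (\<lambda>i. p i - q i) I"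
  shows "real (card P) \<le> (1 + 2 / \<delta>) ^ card I"
proof -
  define M where "M = Pi\<^sub>M I (\<lambda>_. lborel :: real measure)"
  define C where "C r p = {a \<in> space M. L2_set (\<lambda>i. a i - p i) I \<le> r}" for r and p :: "'i \<Rightarrow> real"
  define v where "v = unit_ball_vol (card I)"
  have v: "v > 0" by (simp add: v_def)
  have C_sets: "C r p \<in> sets M" for r p
    unfolding C_def M_def L2_set_def by measurable
  have C_meas: "emeasure M (C r p) = ennreal (v * r ^ card I)" if "r > 0" for r p
    unfolding C_def M_def v_def using emeasure_PiM_lborel_translated_ball[OF I that] .
  have disj: "disjoint_family_on (C (\<delta> / 2)) P"
  unfolding disjoint_family_on_def
  proof (intro ballI impI, rule ccontr)
    fix p q assume pq: "p \<in> P" "q \<in> P" "p \<noteq> q" "C (\<delta> / 2) p \<inter> C (\<delta> / 2) q \<noteq> {}"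
    then obtain a where a: "L2_set (\<lambda>i. a i - p i) I \<le> \<delta> / 2" "L2_set (\<lambda>i. a i - q i) I \<le> \<delta> / 2"
      by (auto simp: C_def)
    have "L2_set (\<lambda>i. p i - q i) I \<le> L2_set (\<lambda>i. p i - a i) I + L2_set (\<lambda>i. a i - q i) I"
      using L2_set_triangle_ineq[of "\<lambda>i. p i - a i" "\<lambda>i. a i - q i" I] by simp
    also have "L2_set (\<lambda>i. p i - a i) I = L2_set (\<lambda>i. a i - p i) I"
      by (simp add: L2_set_def power2_commute)
    finally show False
      using a sep[OF pq(1-3)] by simp
  qed
  have "ennreal (card P * (v * (\<delta> / 2) ^ card I)) = (\<Sum>p\<in>P. emeasure M (C (\<delta> / 2) p))"
    using \<delta> v by (simp add: C_meas ennreal_mult ennreal_of_nat_eq_real_of_nat)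
  also have "\<dots> = emeasure M (\<Union>p\<in>P. C (\<delta> / 2) p)"
    using C_sets disj P by (intro sum_emeasure) auto
  also have "\<dots> \<le> emeasure M (C (1 + \<delta> / 2) (\<lambda>_. 0))"
  proof (intro emeasure_mono UN_least subsetI C_sets)
    fix p a assume "p \<in> P" "a \<in> C (\<delta> / 2) p"
    then show "a \<in> C (1 + \<delta> / 2) (\<lambda>_. 0)"
      using ball[of p] L2_set_triangle_ineq[of p "\<lambda>i. a i - p i" I] by (auto simp: C_def)
  qed
  also have "\<dots> = ennreal (v * (1 + \<delta> / 2) ^ card I)"
    using \<delta> by (intro C_meas) auto
  finally have "card P * (\<delta> / 2) ^ card I \<le> (1 + \<delta> / 2) ^ card I"
    using v \<delta> by (simp add: algebra_simps)
  also have "1 + \<delta> / 2 = (1 + 2 / \<delta>) * (\<delta> / 2)"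
    using \<delta> by (simp add: field_simps)
  finally show ?thesis
    using \<delta> by (simp only: power_mult_distrib) simp
qed

text \<open>
  A separated set of maximal cardinality is a net, since a point far from all its members could be added.
\<close>
lemma unit_ball_finite_net:
  fixes I :: "'i set"
  assumes I: "finite I" and \<delta>: "\<delta> > 0"
  obtains P :: "('i \<Rightarrow> real) set"
  where "finite P" "P \<noteq> {}" "real (card P) \<le> (1 + 2 / \<delta>) ^ card I"
    "\<And>a. L2_set a I \<le> 1 \<Longrightarrow> \<exists>p\<in>P. L2_set (\<lambda>i. a i - p i) I \<le> \<delta>"
proof -
  define separated where "separated P \<longleftrightarrow> finite P \<and> P \<subseteq> extensional I \<and> (\<forall>p\<in>P. L2_set p I \<le> 1) \<and>
    (\<forall>p\<in>P. \<forall>q\<in>P. p \<noteq> q \<longrightarrow> \<delta> < L2_set (\<lambda>i. p i - q i) I)" for P :: "('i \<Rightarrow> real) set"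
  have card_le: "real (card P) \<le> (1 + 2 / \<delta>) ^ card I" if "separated P" for P
    using that by (intro card_separated_unit_ball_le[OF I \<delta>]) (auto simp: separated_def)
  have "separated {}"
    by (simp add: separated_def)
  moreover have "\<forall>P. separated P \<longrightarrow> card P \<le> nat \<lfloor>(1 + 2 / \<delta>) ^ card I\<rfloor>"
    using card_le by (simp add: le_nat_floor)
  ultimately obtain P where P: "separated P" and max: "\<And>Q. separated Q \<Longrightarrow> card Q \<le> card P"
    using ex_has_greatest_nat[of separated "{}" card] by (metis le_imp_less_Suc)
  have net: "\<exists>p\<in>P. L2_set (\<lambda>i. a i - p i) I \<le> \<delta>" if a: "L2_set a I \<le> 1" for a
  proof (rule ccontr)
    assume far: "\<not> ?thesis"
    \<comment> \<open>members of \<open>P\<close> are extensional, so \<open>a\<close> is first restricted to \<open>I\<close>\<close>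
    define b where "b = restrict a I"
    have b: "L2_set b I \<le> 1" "L2_set (\<lambda>i. b i - p i) I = L2_set (\<lambda>i. a i - p i) I" for p
      using a by (auto simp: b_def L2_set_def)
    have sym: "L2_set (\<lambda>i. p i - b i) I = L2_set (\<lambda>i. b i - p i) I" for p
      by (simp add: L2_set_def power2_commute)
    have "b \<notin> P"
    proof
      assume "b \<in> P"
      moreover have "L2_set (\<lambda>i. a i - b i) I \<le> \<delta>"
        using b(2)[of b] \<delta> by (simp add: L2_set_def)
      ultimately show False
        using far by blast
    qed
    have "separated (insert b P)"
      using P b far sym by (auto simp: separated_def b_def not_le)
    from max[OF this] \<open>b \<notin> P\<close> P show False
      by (simp add: separated_def)
  qed
  show thesis
  proof (rule that[of P])
    show "P \<noteq> {}"
      using net[of "\<lambda>_. 0"] by (auto simp: L2_set_0')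
  qed (use P card_le net in \<open>auto simp: separated_def\<close>)
qed

section \<open>Kernel interpolation in reproducing kernel Hilbert spaces\<close>

context function_hilbert_space
begin

lemma diff_mem: "f \<in> H \<Longrightarrow> g \<in> H \<Longrightarrow> (\<lambda>x. f x - g x) \<in> H"
  using add_mem[OF _ scale_mem[of g "-1"], of f] by simp

lemma ip_diff_left:
  "f \<in> H \<Longrightarrow> g \<in> H \<Longrightarrow> h \<in> H \<Longrightarrow> ip (\<lambda>x. f x - g x) h = ip f h - ip g h"
  using ip_add_left[OF _ scale_mem[of g "-1"], of f h] ip_scale_left[of g h "-1"] by simp

lemma sum_mem:
  "finite S \<Longrightarrow> (\<And>s. s \<in> S \<Longrightarrow> u s \<in> H) \<Longrightarrow> (\<lambda>x. \<Sum>s\<in>S. c s * u s x) \<in> H"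
proof (induction S rule: finite_induct)
  case (insert t S)
  then show ?case
    using add_mem[OF scale_mem[of "u t" "c t"], of "\<lambda>x. \<Sum>s\<in>S. c s * u s x"] by simp
qed (simp add: zero_mem)

lemma ip_sum_left:
  assumes "finite S" "\<And>s. s \<in> S \<Longrightarrow> u s \<in> H" "h \<in> H"
  shows "ip (\<lambda>x. \<Sum>s\<in>S. c s * u s x) h = (\<Sum>s\<in>S. c s * ip (u s) h)"
  using assms
proof (induction S rule: finite_induct)
  case empty
  then show ?case
    using ip_scale_left[OF zero_mem, of h 0] by simp
next
  case (insert t S)
  then show ?case
    using ip_add_left[OF scale_mem[of "u t" "c t"] sum_mem[of S u c], of h]
      ip_scale_left[of "u t" h "c t"] by simp
qed

lemma ip_diff_self:
  assumes "f \<in> H" "g \<in> H"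
  shows "ip (\<lambda>x. f x - g x) (\<lambda>x. f x - g x) = ip f f - 2 * ip f g + ip g g"
proof -
  have "ip (\<lambda>x. f x - g x) (\<lambda>x. f x - g x) = ip f (\<lambda>x. f x - g x) - ip g (\<lambda>x. f x - g x)"
    using assms by (intro ip_diff_left diff_mem)
  also have "ip f (\<lambda>x. f x - g x) = ip f f - ip g f"
    using assms ip_commute[OF _ diff_mem] ip_diff_left by simp
  also have "ip g (\<lambda>x. f x - g x) = ip f g - ip g g"
    using assms ip_commute[OF _ diff_mem] ip_diff_left by simp
  finally show ?thesis
    using assms ip_commute by simp
qed

lemma Cauchy_Schwarz:
  assumes f: "f \<in> H" and g: "g \<in> H"
  shows "(ip f g)\<^sup>2 \<le> ip f f * ip g g"
proof (cases "ip g g = 0")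
  case True
  then have "g = (\<lambda>x. 0)"
    using g ip_definite by blast
  then have "ip g f = 0"
    using ip_scale_left[OF f f, of 0] by simp
  then show ?thesis
    using True f g ip_commute by simp
next
  case False
  then have gg: "ip g g > 0"
    using ip_nonneg[OF g] by simp
  define t where "t = ip f g / ip g g"
  have tg: "(\<lambda>x. t * g x) \<in> H"
    using g by (rule scale_mem)
  have "0 \<le> ip (\<lambda>x. f x - t * g x) (\<lambda>x. f x - t * g x)"
    using f tg by (intro ip_nonneg diff_mem)
  also have "\<dots> = ip f f - 2 * (t * ip f g) + t * (t * ip g g)"
    using f g tg ip_diff_self[OF f tg] ip_commute[OF f tg] ip_commute[OF g tg] ip_commute[OF f g]
    by (simp add: ip_scale_left)
  also have "\<dots> = ip f f - (ip f g)\<^sup>2 / ip g g"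
    using gg by (simp add: t_def field_simps power2_eq_square)
  finally show ?thesis
    using gg by (simp add: field_simps)
qed

text \<open>
  The coefficients of the orthogonal projection of \<open>f\<close> onto the span of finitely many vectors \<open>u s\<close>,
  which may be linearly dependent. The induction is a Gram--Schmidt step: \<open>v\<close> is the part of the new
  vector orthogonal to the old ones, and the component of the residual along \<open>v\<close> is subtracted. If
  \<open>v = 0\<close>, the new vector lies in the old span; then \<open>b = 0\<close> by the convention for division by zero,
  and nothing is subtracted.
\<close>
lemma finite_projection:
  assumes "finite S" "\<And>s. s \<in> S \<Longrightarrow> u s \<in> H" "f \<in> H"
  shows "\<exists>c. \<forall>t\<in>S. ip (\<lambda>x. f x - (\<Sum>s\<in>S. c s * u s x)) (u t) = 0"
  using assms
proof (induction S arbitrary: f rule: finite_induct)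
  case (insert t S)
  have u: "\<And>s. s \<in> S \<Longrightarrow> u s \<in> H" and ut: "u t \<in> H" and f: "f \<in> H"
    using insert.prems by auto
  obtain c where c: "\<And>s. s \<in> S \<Longrightarrow> ip (\<lambda>x. f x - (\<Sum>s\<in>S. c s * u s x)) (u s) = 0"
    using insert.IH[OF u f] by blast
  obtain e where e: "\<And>s. s \<in> S \<Longrightarrow> ip (\<lambda>x. u t x - (\<Sum>s\<in>S. e s * u s x)) (u s) = 0"
    using insert.IH[OF u ut] by blast
  define g where "g = (\<lambda>x. f x - (\<Sum>s\<in>S. c s * u s x))"
  define p where "p = (\<lambda>x. \<Sum>s\<in>S. e s * u s x)"
  define v where "v = (\<lambda>x. u t x - p x)"
  define b where "b = ip g v / ip v v"
  have p: "p \<in> H" and g: "g \<in> H"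
    unfolding p_def g_def using u f insert.hyps by (auto intro!: sum_mem diff_mem)
  then have v: "v \<in> H"
    unfolding v_def using ut by (intro diff_mem)
  have bv: "(\<lambda>x. b * v x) \<in> H"
    using v by (rule scale_mem)
  define r where "r = (\<lambda>x. g x - b * v x)"
  have r: "r \<in> H"
    unfolding r_def using g bv by (rule diff_mem)
  have ip_r: "ip r h = ip g h - b * ip v h" if "h \<in> H" for h
    unfolding r_def using that g v bv by (simp add: ip_diff_left ip_scale_left)
  have r_S: "ip r (u s) = 0" if "s \<in> S" for s
    using that u c e by (simp add: ip_r g_def v_def p_def)
  have "ip v v = 0 \<Longrightarrow> ip g v = 0"
    using Cauchy_Schwarz[OF g v] by simp
  then have "ip r v = 0"
    using v by (simp add: ip_r b_def)
  moreover have "ip r p = 0"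
    using u r insert.hyps r_S unfolding ip_commute[OF r p]
    by (simp add: p_def ip_sum_left ip_commute[OF u r])
  ultimately have "ip r (u t) = 0"
    using ip_diff_left[OF ut p r] ip_commute[OF r] ut p v by (simp add: v_def)
  moreover have "r = (\<lambda>x. f x - (\<Sum>s\<in>insert t S. (if s = t then b else c s - b * e s) * u s x))"
  proof
    fix x
    have "(\<Sum>s\<in>S. (if s = t then b else c s - b * e s) * u s x)
        = (\<Sum>s\<in>S. c s * u s x - b * (e s * u s x))"
      using insert.hyps by (intro sum.cong) (auto simp: algebra_simps)
    then show "r x = f x - (\<Sum>s\<in>insert t S. (if s = t then b else c s - b * e s) * u s x)"
      using insert.hyps
      by (simp add: r_def g_def v_def p_def sum_subtractf sum_distrib_left algebra_simps)
  qed
  ultimately show ?case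
    using r_S by auto
qed simp

end

context rkhs
begin

abbreviation "kernel_section x \<equiv> zero_ext X (\<lambda>y. k y x)"

lemma ip_kernel_sections:
  "x \<in> X \<Longrightarrow> y \<in> X \<Longrightarrow> ip (kernel_section x) (kernel_section y) = k y x"
  using reproducing[OF kernel_mem] by (simp add: zero_ext_def)

text \<open>
  Since \<open>f x - f y = \<langle>f, k\<^sub>x - k\<^sub>y\<rangle>\<close>, the Cauchy--Schwarz inequality makes every \<open>f\<close> in the unit ball
  1-Lipschitz for the distance \<open>|k\<^sub>x - k\<^sub>y|\<close> in the Hilbert space.
\<close>
lemma abs_diff_le:
  assumes f: "f \<in> H" "ip f f \<le> 1" and xy: "x \<in> X" "y \<in> X"
    and \<eta>: "0 \<le> \<eta>" "k x x - 2 * k x y + k y y \<le> \<eta>\<^sup>2"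
  shows "\<bar>f x - f y\<bar> \<le> \<eta>"
proof -
  let ?h = "\<lambda>z. kernel_section x z - kernel_section y z"
  have h: "?h \<in> H"
    using xy by (intro diff_mem kernel_mem)
  have "f x - f y = ip f ?h"
    using f(1) xy ip_commute[OF f(1) h] ip_diff_left[of "kernel_section x" "kernel_section y" f]
      ip_commute[OF f(1) kernel_mem] kernel_mem reproducing by (metis (no_types, lifting))
  then have "(f x - f y)\<^sup>2 \<le> ip f f * ip ?h ?h"
    using Cauchy_Schwarz[OF f(1) h] by simp
  also have "\<dots> \<le> 1 * \<eta>\<^sup>2"
  proof (intro mult_mono)
    show "ip ?h ?h \<le> \<eta>\<^sup>2"
      using \<eta>(2) xy ip_diff_self[of "kernel_section x" "kernel_section y"] kernel_mem
        ip_kernel_sections ip_commute[of "kernel_section x" "kernel_section y"] by simp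
  qed (use f h ip_nonneg in auto)
  finally show ?thesis
    using \<eta>(1) by (simp add: abs_le_square_iff[symmetric])
qed

text \<open>
  Being orthogonal to the kernel section at \<open>t\<close> means vanishing at \<open>t\<close>, so the projection of \<open>f\<close> onto the
  sections at \<open>S\<close> interpolates \<open>f\<close> on \<open>S\<close>. A projection does not increase the norm, and the squared norm
  of the interpolant is the quadratic form of \<open>k\<close> at its coefficients.
\<close>
lemma kernel_interpolant:
  assumes S: "finite S" "S \<subseteq> X" and f: "f \<in> H" "ip f f \<le> 1"
  obtains c :: "'a \<Rightarrow> real" where "(\<lambda>x. \<Sum>s\<in>S. c s * kernel_section s x) \<in> H"
    "\<And>t. t \<in> S \<Longrightarrow> (\<Sum>s\<in>S. c s * k t s) = f t"
    "(\<Sum>s\<in>S. \<Sum>t\<in>S. c s * c t * k s t) \<le> 1"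
    "ip (\<lambda>x. \<Sum>s\<in>S. c s * kernel_section s x) (\<lambda>x. \<Sum>s\<in>S. c s * kernel_section s x) \<le> 1"
proof -
  have u: "kernel_section s \<in> H" if "s \<in> S" for s
    using that S by (auto intro: kernel_mem)
  obtain c where c: "\<And>t. t \<in> S \<Longrightarrow>
      ip (\<lambda>x. f x - (\<Sum>s\<in>S. c s * kernel_section s x)) (kernel_section t) = 0"
    using finite_projection[of S kernel_section f] S(1) u f(1) by blast
  define g where "g = (\<lambda>x. \<Sum>s\<in>S. c s * kernel_section s x)"
  have g: "g \<in> H"
    unfolding g_def using S u by (intro sum_mem) auto
  let ?r = "\<lambda>x. f x - g x"
  have r: "?r \<in> H"
    using f(1) g by (rule diff_mem)
  have "ip g ?r = (\<Sum>s\<in>S. c s * ip (kernel_section s) ?r)"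
    unfolding g_def using S(1) u r g_def by (intro ip_sum_left) auto
  also have "\<dots> = 0"
    using c ip_commute[OF r u] by (intro sum.neutral) (auto simp: g_def)
  finally have "ip f g = ip g g"
    using ip_commute[OF r g] ip_diff_left[OF f(1) g g] by simp
  then have gg: "ip g g \<le> 1"
    using ip_nonneg[OF r] ip_diff_self[OF f(1) g] f(2) by simp
  have g_at: "g t = (\<Sum>s\<in>S. c s * k t s)" if "t \<in> S" for t
    using that S by (auto simp: g_def zero_ext_def)
  show thesis
  proof (rule that[of c])
    show "(\<Sum>s\<in>S. c s * k t s) = f t" if "t \<in> S" for t
      using c[OF that] reproducing[OF r, of t] g_at[OF that] that S by (auto simp: g_def)
    have "ip g g = (\<Sum>s\<in>S. c s * ip (kernel_section s) g)"
      using ip_sum_left[where c = c, OF S(1) u g] by (simp add: g_def)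
    also have "\<dots> = (\<Sum>s\<in>S. c s * g s)"
    proof (rule sum.cong)
      fix s assume "s \<in> S"
      then show "c s * ip (kernel_section s) g = c s * g s"
        using ip_commute[OF u g] reproducing[OF g] S by auto
    qed simp
    also have "\<dots> = (\<Sum>s\<in>S. \<Sum>t\<in>S. c s * c t * k s t)"
      by (intro sum.cong refl) (simp add: g_at sum_distrib_left mult.assoc)
    finally show "(\<Sum>s\<in>S. \<Sum>t\<in>S. c s * c t * k s t) \<le> 1"
      using gg by simp
  qed (use g gg in \<open>auto simp: g_def\<close>)
qed

text \<open>
  From any \<open>x\<close> one moves to a nearby \<open>s \<in> S\<close>, where \<open>f\<close> and its interpolant agree, and back; each of the
  two moves costs \<open>\<eta>\<close>.
\<close>
lemma uniform_approx_by_kernel_sections: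
  assumes f: "f \<in> H" "ip f f \<le> 1" and S: "finite S" "S \<subseteq> X" and \<eta>: "0 \<le> \<eta>"
    and net: "\<And>x. x \<in> X \<Longrightarrow> \<exists>s\<in>S. k x x - 2 * k x s + k s s \<le> \<eta>\<^sup>2"
  obtains c :: "'a \<Rightarrow> real" where "(\<Sum>s\<in>S. \<Sum>t\<in>S. c s * c t * k s t) \<le> 1"
    "\<And>x. x \<in> X \<Longrightarrow> \<bar>f x - (\<Sum>s\<in>S. c s * k x s)\<bar> \<le> 2 * \<eta>"
proof -
  obtain c where g: "(\<lambda>x. \<Sum>s\<in>S. c s * kernel_section s x) \<in> H"
    and eq: "\<And>t. t \<in> S \<Longrightarrow> (\<Sum>s\<in>S. c s * k t s) = f t"
    and quad: "(\<Sum>s\<in>S. \<Sum>t\<in>S. c s * c t * k s t) \<le> 1"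
    and gg: "ip (\<lambda>x. \<Sum>s\<in>S. c s * kernel_section s x) (\<lambda>x. \<Sum>s\<in>S. c s * kernel_section s x) \<le> 1"
    using kernel_interpolant[OF S f] by blast
  have "\<bar>f x - (\<Sum>s\<in>S. c s * k x s)\<bar> \<le> 2 * \<eta>" if x: "x \<in> X" for x
  proof -
    obtain s where s: "s \<in> S" "k x x - 2 * k x s + k s s \<le> \<eta>\<^sup>2"
      using net[OF x] by blast
    then have "s \<in> X"
      using S by auto
    then show ?thesis
      using abs_diff_le[OF f x \<open>s \<in> X\<close> \<eta> s(2)] abs_diff_le[OF g gg x \<open>s \<in> X\<close> \<eta> s(2)] eq[OF s(1)] x
      by (simp add: zero_ext_def)
  qed
  with quad that show thesis by blast
qed

end

section \<open>Covering numbers from a feature expansion of the kernel\<close>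

text \<open>
  The vector \<open>a\<close> holds the coefficients of \<open>g = \<Sum>\<^sub>s c\<^sub>s k (\<cdot>, s)\<close> with respect to the features. Its squared
  length over all features is the quadratic form of \<open>k\<close> at \<open>c\<close>, hence at most one, and the
  Cauchy--Schwarz inequality bounds the part of the expansion of \<open>g\<close> outside \<open>F m\<close>. Both facts are
  proved for the partial sums over \<open>F N\<close>, then \<open>N\<close> tends to infinity.
\<close>
lemma truncated_feature_expansion:
  fixes \<Phi> :: "'i \<Rightarrow> 'a \<Rightarrow> real" and F :: "nat \<Rightarrow> 'i set"
    and k :: "'a \<Rightarrow> 'a \<Rightarrow> real" and c :: "'a \<Rightarrow> real"
  assumes F: "\<And>N. finite (F N)" "mono F"
    and lim: "\<And>x y. x \<in> X \<Longrightarrow> y \<in> X \<Longrightarrow> (\<lambda>N. \<Sum>\<alpha>\<in>F N. \<Phi> \<alpha> x * \<Phi> \<alpha> y) \<longlonglongrightarrow> k x y"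
    and tail: "\<And>x N. x \<in> X \<Longrightarrow> (\<Sum>\<alpha>\<in>F N - F m. (\<Phi> \<alpha> x)\<^sup>2) \<le> \<tau>\<^sup>2" and \<tau>: "0 \<le> \<tau>"
    and S: "finite S" "S \<subseteq> X" and quad: "(\<Sum>s\<in>S. \<Sum>t\<in>S. c s * c t * k s t) \<le> 1"
  defines "a \<alpha> \<equiv> \<Sum>s\<in>S. c s * \<Phi> \<alpha> s"
  shows "L2_set a (F m) \<le> 1"
    and "x \<in> X \<Longrightarrow> \<bar>(\<Sum>s\<in>S. c s * k x s) - (\<Sum>\<alpha>\<in>F m. a \<alpha> * \<Phi> \<alpha> x)\<bar> \<le> \<tau>"
proof -
  have SX: "s \<in> X" if "s \<in> S" for s
    using that S by auto
  have a2: "(\<Sum>\<alpha>\<in>F N. (a \<alpha>)\<^sup>2) \<le> 1" for N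
  proof -
    have "(\<Sum>\<alpha>\<in>F N. (a \<alpha>)\<^sup>2) = (\<Sum>\<alpha>\<in>F N. \<Sum>s\<in>S. \<Sum>t\<in>S. c s * c t * (\<Phi> \<alpha> s * \<Phi> \<alpha> t))" for N
      by (intro sum.cong) (simp_all add: a_def power2_eq_square sum_product algebra_simps)
    also have "\<dots> N = (\<Sum>s\<in>S. \<Sum>t\<in>S. c s * c t * (\<Sum>\<alpha>\<in>F N. \<Phi> \<alpha> s * \<Phi> \<alpha> t))" for N
      by (simp add: sum_distrib_left sum.swap[of _ S "F N"])
    finally have eq: "(\<Sum>\<alpha>\<in>F N. (a \<alpha>)\<^sup>2)
        = (\<Sum>s\<in>S. \<Sum>t\<in>S. c s * c t * (\<Sum>\<alpha>\<in>F N. \<Phi> \<alpha> s * \<Phi> \<alpha> t))" for N .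
    have "(\<lambda>N. \<Sum>\<alpha>\<in>F N. (a \<alpha>)\<^sup>2) \<longlonglongrightarrow> (\<Sum>s\<in>S. \<Sum>t\<in>S. c s * c t * k s t)"
      unfolding eq by (intro tendsto_intros lim SX)
    moreover have "incseq (\<lambda>N. \<Sum>\<alpha>\<in>F N. (a \<alpha>)\<^sup>2)"
      using F by (intro monoI sum_mono2) (auto dest: monoD)
    ultimately show ?thesis
      using incseq_le[of "\<lambda>N. \<Sum>\<alpha>\<in>F N. (a \<alpha>)\<^sup>2" _ N] quad by (blast intro: order_trans)
  qed
  then show "L2_set a (F m) \<le> 1"
    by (simp add: L2_set_def)
  show "\<bar>(\<Sum>s\<in>S. c s * k x s) - (\<Sum>\<alpha>\<in>F m. a \<alpha> * \<Phi> \<alpha> x)\<bar> \<le> \<tau>" if x: "x \<in> X"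
  proof (rule LIMSEQ_le_const2)
    have eq: "(\<Sum>\<alpha>\<in>F N. a \<alpha> * \<Phi> \<alpha> x) = (\<Sum>s\<in>S. c s * (\<Sum>\<alpha>\<in>F N. \<Phi> \<alpha> x * \<Phi> \<alpha> s))" for N
      by (simp add: a_def sum_distrib_left sum_distrib_right sum.swap[of _ S "F N"] mult_ac)
    show "(\<lambda>N. \<bar>(\<Sum>\<alpha>\<in>F N. a \<alpha> * \<Phi> \<alpha> x) - (\<Sum>\<alpha>\<in>F m. a \<alpha> * \<Phi> \<alpha> x)\<bar>)
        \<longlonglongrightarrow> \<bar>(\<Sum>s\<in>S. c s * k x s) - (\<Sum>\<alpha>\<in>F m. a \<alpha> * \<Phi> \<alpha> x)\<bar>"
      unfolding eq by (intro tendsto_intros lim SX x)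
    show "\<exists>N. \<forall>n\<ge>N. \<bar>(\<Sum>\<alpha>\<in>F n. a \<alpha> * \<Phi> \<alpha> x) - (\<Sum>\<alpha>\<in>F m. a \<alpha> * \<Phi> \<alpha> x)\<bar> \<le> \<tau>"
    proof (intro exI allI impI)
      fix N assume "m \<le> N"
      then have "F m \<subseteq> F N"
        using F(2) by (rule monoD[rotated])
      then have "\<bar>(\<Sum>\<alpha>\<in>F N. a \<alpha> * \<Phi> \<alpha> x) - (\<Sum>\<alpha>\<in>F m. a \<alpha> * \<Phi> \<alpha> x)\<bar>
          = \<bar>\<Sum>\<alpha>\<in>F N - F m. a \<alpha> * \<Phi> \<alpha> x\<bar>"
        using F(1) by (simp add: sum_diff)
      also have "\<dots> \<le> (\<Sum>\<alpha>\<in>F N - F m. \<bar>a \<alpha>\<bar> * \<bar>\<Phi> \<alpha> x\<bar>)"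
        by (rule order_trans[OF sum_abs]) (simp add: abs_mult)
      also have "\<dots> \<le> L2_set a (F N - F m) * L2_set (\<lambda>\<alpha>. \<Phi> \<alpha> x) (F N - F m)"
        by (rule L2_set_mult_ineq)
      also have "\<dots> \<le> 1 * \<tau>"
      proof (intro mult_mono)
        have "(\<Sum>\<alpha>\<in>F N - F m. (a \<alpha>)\<^sup>2) \<le> (\<Sum>\<alpha>\<in>F N. (a \<alpha>)\<^sup>2)"
          using F(1) by (intro sum_mono2) auto
        then show "L2_set a (F N - F m) \<le> 1"
          using a2[of N] by (simp add: L2_set_def)
        show "L2_set (\<lambda>\<alpha>. \<Phi> \<alpha> x) (F N - F m) \<le> \<tau>"
          using tail[OF x, of N] \<tau> unfolding L2_set_def by (intro real_le_lsqrt)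
      qed auto
      finally show "\<bar>(\<Sum>\<alpha>\<in>F N. a \<alpha> * \<Phi> \<alpha> x) - (\<Sum>\<alpha>\<in>F m. a \<alpha> * \<Phi> \<alpha> x)\<bar> \<le> \<tau>"
        by simp
    qed
  qed
qed

lemma log_covering_number_le_ln_card:
  assumes P: "finite P" "P \<noteq> {}" and mem: "\<And>p. p \<in> P \<Longrightarrow> g p \<in> F"
    and cover: "\<And>f. f \<in> unit_ball E nE \<Longrightarrow> \<exists>p\<in>P. \<exists>b\<in>unit_ball F nF. T f = (\<lambda>x. g p x + \<epsilon> * b x)"
  shows "log_covering_number E nE F nF T \<epsilon> \<le> ereal (ln (real (card P)))"
proof -
  obtain h where h: "bij_betw h {1..card P} P"
    using ex_bij_betw_nat_finite_1[OF P(1)] by blast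
  have n: "1 \<le> card P"
    using P by (simp add: Suc_le_eq card_gt_0_iff)
  have "T ` unit_ball E nE
      \<subseteq> (\<Union>i\<in>{1..card P}. {(\<lambda>x. g (h i) x + \<epsilon> * b x) | b. b \<in> unit_ball F nF})"
  proof
    fix u assume "u \<in> T ` unit_ball E nE"
    then obtain f where f: "f \<in> unit_ball E nE" "u = T f"
      by (rule imageE) simp
    obtain p b where p: "p \<in> P" and b: "b \<in> unit_ball F nF" "u = (\<lambda>x. g p x + \<epsilon> * b x)"
      using cover[OF f(1)] unfolding f(2) by (elim bexE)
    obtain i where i: "i \<in> {1..card P}" "p = h i"
      using h p unfolding bij_betw_def by (metis imageE)
    show "u \<in> (\<Union>i\<in>{1..card P}. {(\<lambda>x. g (h i) x + \<epsilon> * b x) | b. b \<in> unit_ball F nF})"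
      using b unfolding i(2) by (intro UN_I[OF i(1)] CollectI exI[of _ b] conjI)
  qed
  moreover have "\<forall>i\<in>{1..card P}. g (h i) \<in> F"
    using h mem by (auto simp: bij_betw_def)
  ultimately have le: "covering_number F nF (T ` unit_ball E nE) \<epsilon> \<le> enat (card P)"
    unfolding covering_number_def using n by (intro Inf_lower CollectI exI conjI) (rule refl)
  then obtain m where m: "covering_number F nF (T ` unit_ball E nE) \<epsilon> = enat m" "m \<le> card P"
    by (metis enat_ile enat_ord_simps(1))
  then have "ln (real m) \<le> ln (real (card P))"
    using n by (cases "m = 0") auto
  then show ?thesis
    by (simp add: log_covering_number_def m(1))
qed

text \<open>
  The radius is split into the truncation error \<open>\<tau>\<close>, the mesh \<open>\<delta>\<close> of a net in the space of coefficient
  vectors, and what is left for interpolating at finitely many points. A mesh \<open>\<delta>\<close> in the Euclidean norm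
  of the coefficients is a mesh \<open>\<delta>\<close> in the supremum norm, because the feature vector at \<open>x\<close> has
  squared length at most \<open>k (x, x) \<le> 1\<close>.
\<close>
lemma (in rkhs) log_covering_number_le_by_features:
  fixes \<Phi> :: "'i \<Rightarrow> 'a \<Rightarrow> real" and F :: "nat \<Rightarrow> 'i set"
  assumes X: "X \<noteq> {}" and k_le: "\<And>x. x \<in> X \<Longrightarrow> k x x \<le> 1"
    and net: "\<And>\<eta>. 0 < \<eta> \<Longrightarrow> \<exists>S. finite S \<and> S \<subseteq> X \<and>
      (\<forall>x\<in>X. \<exists>s\<in>S. k x x - 2 * k x s + k s s \<le> \<eta>\<^sup>2)"
    and F: "\<And>N. finite (F N)" "mono F"
    and lim: "\<And>x y. x \<in> X \<Longrightarrow> y \<in> X \<Longrightarrow> (\<lambda>N. \<Sum>\<alpha>\<in>F N. \<Phi> \<alpha> x * \<Phi> \<alpha> y) \<longlonglongrightarrow> k x y"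
    and tail: "\<And>x N. x \<in> X \<Longrightarrow> (\<Sum>\<alpha>\<in>F N - F m. (\<Phi> \<alpha> x)\<^sup>2) \<le> \<tau>\<^sup>2"
    and pos: "0 \<le> \<tau>" "0 < \<delta>" "\<tau> + \<delta> < \<epsilon>"
  shows "log_covering_number H (ip_norm ip) (ell_infty X) (sup_norm X) (\<lambda>f. f) \<epsilon>
    \<le> ereal (card (F m) * ln (1 + 2 / \<delta>))"
proof -
  obtain P :: "('i \<Rightarrow> real) set" where P: "finite P" "P \<noteq> {}"
    and card_P: "real (card P) \<le> (1 + 2 / \<delta>) ^ card (F m)"
    and P_net: "\<And>a. L2_set a (F m) \<le> 1 \<Longrightarrow> \<exists>p\<in>P. L2_set (\<lambda>\<alpha>. a \<alpha> - p \<alpha>) (F m) \<le> \<delta>"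
    using unit_ball_finite_net[OF F(1) pos(2)] by blast
  \<comment> \<open>half of the remaining error, since interpolation on a net costs \<open>2 * \<eta>\<close>\<close>
  define \<eta> where "\<eta> = (\<epsilon> - \<tau> - \<delta>) / 2"
  have \<eta>: "0 < \<eta>"
    using pos by (simp add: \<eta>_def)
  obtain S where S: "finite S" "S \<subseteq> X"
    and S_net: "\<And>x. x \<in> X \<Longrightarrow> \<exists>s\<in>S. k x x - 2 * k x s + k s s \<le> \<eta>\<^sup>2"
    using net[OF \<eta>] by blast
  define comb where "comb a x = (\<Sum>\<alpha>\<in>F m. a \<alpha> * \<Phi> \<alpha> x)" for a x
  have comb_le: "\<bar>comb a x\<bar> \<le> L2_set a (F m)" if x: "x \<in> X" for a x
  proof -
    have "(\<Sum>\<alpha>\<in>F m. (\<Phi> \<alpha> x)\<^sup>2) \<le> k x x"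
    proof (rule incseq_le)
      show "incseq (\<lambda>N. \<Sum>\<alpha>\<in>F N. (\<Phi> \<alpha> x)\<^sup>2)"
        using F by (intro monoI sum_mono2) (auto dest: monoD)
      show "(\<lambda>N. \<Sum>\<alpha>\<in>F N. (\<Phi> \<alpha> x)\<^sup>2) \<longlonglongrightarrow> k x x"
        using lim[OF x x] by (simp add: power2_eq_square)
    qed
    then have feat: "L2_set (\<lambda>\<alpha>. \<Phi> \<alpha> x) (F m) \<le> 1"
      using k_le[OF x] by (simp add: L2_set_def)
    have "\<bar>comb a x\<bar> \<le> (\<Sum>\<alpha>\<in>F m. \<bar>a \<alpha>\<bar> * \<bar>\<Phi> \<alpha> x\<bar>)"
      unfolding comb_def by (rule order_trans[OF sum_abs]) (simp add: abs_mult)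
    also have "\<dots> \<le> L2_set a (F m) * L2_set (\<lambda>\<alpha>. \<Phi> \<alpha> x) (F m)"
      by (rule L2_set_mult_ineq)
    also have "\<dots> \<le> L2_set a (F m)"
      using feat by (simp add: mult_left_le)
    finally show ?thesis .
  qed
  have comb_mem: "zero_ext X (comb a) \<in> ell_infty X" for a
    unfolding ell_infty_def zero_ext_def bounded_iff using comb_le by auto
  have "log_covering_number H (ip_norm ip) (ell_infty X) (sup_norm X) (\<lambda>f. f) \<epsilon>
      \<le> ereal (ln (real (card P)))"
  proof (rule log_covering_number_le_ln_card[OF P, where g = "\<lambda>p. zero_ext X (comb p)"])
    fix f assume "f \<in> unit_ball H (ip_norm ip)"
    then have f: "f \<in> H" "ip f f \<le> 1"
      by (auto simp: unit_ball_def ip_norm_def)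
    obtain c where quad: "(\<Sum>s\<in>S. \<Sum>t\<in>S. c s * c t * k s t) \<le> 1"
      and c: "\<And>x. x \<in> X \<Longrightarrow> \<bar>f x - (\<Sum>s\<in>S. c s * k x s)\<bar> \<le> 2 * \<eta>"
      using uniform_approx_by_kernel_sections[OF f S less_imp_le[OF \<eta>] S_net] by blast
    define a where "a \<alpha> = (\<Sum>s\<in>S. c s * \<Phi> \<alpha> s)" for \<alpha>
    have expansion: "L2_set a (F m) \<le> 1"
        "\<And>x. x \<in> X \<Longrightarrow> \<bar>(\<Sum>s\<in>S. c s * k x s) - comb a x\<bar> \<le> \<tau>"
      unfolding a_def comb_def
      by (rule truncated_feature_expansion[OF F lim tail pos(1) S quad]; assumption)+
    obtain p where p: "p \<in> P" "L2_set (\<lambda>\<alpha>. a \<alpha> - p \<alpha>) (F m) \<le> \<delta>"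
      using P_net[OF expansion(1)] by blast
    define b where "b x = (f x - zero_ext X (comb p) x) / \<epsilon>" for x
    have "\<bar>f x - comb p x\<bar> \<le> \<epsilon>" if x: "x \<in> X" for x
    proof -
      have "\<bar>comb a x - comb p x\<bar> = \<bar>comb (\<lambda>\<alpha>. a \<alpha> - p \<alpha>) x\<bar>"
        by (simp add: comb_def left_diff_distrib sum_subtractf)
      also have "\<dots> \<le> \<delta>"
        using comb_le[OF x] p(2) by (rule order_trans)
      finally have "\<bar>comb a x - comb p x\<bar> \<le> \<delta>" .
      moreover have "2 * \<eta> = \<epsilon> - \<tau> - \<delta>"
        by (simp add: \<eta>_def)
      ultimately show ?thesis
        using c[OF x] expansion(2)[OF x] by linarith
    qed
    then have b_le: "\<bar>b x\<bar> \<le> 1" if "x \<in> X" for x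
      using that pos by (simp add: b_def zero_ext_def)
    moreover have "b x = 0" if "x \<notin> X" for x
      using that supported[OF f(1)] by (simp add: b_def zero_ext_def)
    ultimately have "b \<in> ell_infty X"
      by (auto simp: ell_infty_def bounded_iff)
    moreover have "sup_norm X b \<le> 1"
      unfolding sup_norm_def using X b_le by (intro cSUP_least)
    ultimately have "b \<in> unit_ball (ell_infty X) (sup_norm X)"
      by (simp add: unit_ball_def)
    moreover have "f = (\<lambda>x. zero_ext X (comb p) x + \<epsilon> * b x)"
      using pos by (auto simp: b_def)
    ultimately show "\<exists>p\<in>P. \<exists>b\<in>unit_ball (ell_infty X) (sup_norm X).
        f = (\<lambda>x. zero_ext X (comb p) x + \<epsilon> * b x)"
      using p(1) by blast
  qed (rule comb_mem)
  also have "ln (real (card P)) \<le> ln ((1 + 2 / \<delta>) ^ card (F m))"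
    using card_P P by (intro ln_mono) (auto simp: card_gt_0_iff)
  also have "\<dots> = card (F m) * ln (1 + 2 / \<delta>)"
    using pos(2) by (simp add: ln_realpow)
  finally show ?thesis by simp
qed

section \<open>Multi-indices and the multinomial expansion\<close>

text \<open>
  Multi-indices supported in \<open>I\<close> with total degree in \<open>D\<close>. Allowing an arbitrary set of degrees lets one
  recursion over \<open>I\<close> serve both single degrees (for the multinomial theorem) and degrees up to a bound
  (for counting).
\<close>
definition multi_indices :: "'i set \<Rightarrow> nat set \<Rightarrow> ('i \<Rightarrow> nat) set" where
  "multi_indices I D = {\<alpha>. (\<forall>i. i \<notin> I \<longrightarrow> \<alpha> i = 0) \<and> sum \<alpha> I \<in> D}"

text \<open>
  Splits a multi-index into its entry at \<open>j\<close> and the rest. The bound \<open>n\<close> on the degrees makes the range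
  of the entry finite.
\<close>
lemma bij_betw_multi_indices_insert:
  assumes "finite I" "j \<notin> I" "D \<subseteq> {..n}"
  shows "bij_betw (\<lambda>(l, \<alpha>). \<alpha>(j := l)) (SIGMA l:{..n}. multi_indices I {s. l + s \<in> D})
    (multi_indices (insert j I) D)"
proof (rule bij_betw_byWitness[where f' = "\<lambda>\<alpha>. (\<alpha> j, \<alpha>(j := 0))"])
  have upd: "(\<Sum>i\<in>I. if i = j then l else \<alpha> i) = sum \<alpha> I" for \<alpha> :: "'a \<Rightarrow> nat" and l
    using assms by (intro sum.cong) auto
  show "(\<lambda>(l, \<alpha>). \<alpha>(j := l)) ` (SIGMA l:{..n}. multi_indices I {s. l + s \<in> D})
      \<subseteq> multi_indices (insert j I) D"
    using assms by (auto simp: multi_indices_def upd)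
  show "(\<lambda>\<alpha>. (\<alpha> j, \<alpha>(j := 0))) ` multi_indices (insert j I) D
      \<subseteq> (SIGMA l:{..n}. multi_indices I {s. l + s \<in> D})"
    using assms by (auto simp: multi_indices_def upd)
qed (use assms in \<open>auto simp: multi_indices_def fun_eq_iff\<close>)

lemma finite_multi_indices:
  "finite I \<Longrightarrow> D \<subseteq> {..n} \<Longrightarrow> finite (multi_indices I D)"
proof (induction I arbitrary: D n rule: finite_induct)
  case empty
  have "multi_indices {} D \<subseteq> {\<lambda>_. 0}"
    by (auto simp: multi_indices_def)
  then show ?case
    by (rule finite_subset) simp
next
  case (insert j I)
  have "finite (SIGMA l:{..n}. multi_indices I {s. l + s \<in> D})"
    using insert.prems by (intro finite_SigmaI insert.IH[where n = n]) auto
  then show ?case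
    using bij_betw_finite[OF bij_betw_multi_indices_insert[OF insert.hyps insert.prems]] by simp
qed

lemma card_multi_indices_atMost:
  fixes I :: "'i set"
  assumes "finite I"
  shows "card (multi_indices I {..n}) = (n + card I) choose card I"
  using assms
proof (induction I arbitrary: n rule: finite_induct)
  case empty
  have "multi_indices {} {..n} = {\<lambda>_::'i. 0}"
    by (auto simp: multi_indices_def)
  then show ?case
    by simp
next
  case (insert j I)
  have "card (multi_indices (insert j I) {..n})
      = card (SIGMA l:{..n}. multi_indices I {s. l + s \<in> {..n}})"
    using bij_betw_same_card[OF bij_betw_multi_indices_insert[OF insert.hyps order.refl[of "{..n}"]]]
    by simp
  also have "\<dots> = (\<Sum>l\<le>n. card (multi_indices I {s. l + s \<in> {..n}}))"
    using insert.hyps by (intro card_SigmaI ballI finite_multi_indices[where n = n]) auto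
  also have "\<dots> = (\<Sum>l\<le>n. (n - l + card I) choose card I)"
  proof (rule sum.cong)
    fix l assume "l \<in> {..n}"
    then have "{s. l + s \<in> {..n}} = {..n - l}"
      by auto
    then show "card (multi_indices I {s. l + s \<in> {..n}}) = (n - l + card I) choose card I"
      using insert.IH by simp
  qed simp
  also have "\<dots> = (\<Sum>l\<le>n. (card I + l) choose card I)"
    using sum.nat_diff_reindex[of "\<lambda>l. (card I + l) choose card I" "Suc n"]
    by (simp add: lessThan_Suc_atMost add.commute)
  also have "\<dots> = (n + card (insert j I)) choose card (insert j I)"
    using insert.hyps choose_rising_sum(1)[of "card I" n] by (simp add: add_ac)
  finally show ?case .
qed

text \<open>
  The multinomial theorem, normalized by the factorials so that the induction step is the binomial
  convolution of exponential series.
\<close>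
lemma multinomial_exp:
  fixes z :: "'i \<Rightarrow> real"
  assumes "finite I"
  shows "(\<Sum>\<alpha>\<in>multi_indices I {k}. \<Prod>i\<in>I. z i ^ \<alpha> i / fact (\<alpha> i)) = (\<Sum>i\<in>I. z i) ^ k / fact k"
  using assms
proof (induction I arbitrary: k rule: finite_induct)
  case empty
  have "multi_indices {} {k} = (if k = 0 then {\<lambda>_::'i. 0} else {})"
    by (auto simp: multi_indices_def)
  then show ?case
    by simp
next
  case (insert j I)
  have fin: "finite (multi_indices I {s. l + s \<in> {k}})" for l
    using insert.hyps by (intro finite_multi_indices[where n = k]) auto
  have "(\<Sum>\<alpha>\<in>multi_indices (insert j I) {k}. \<Prod>i\<in>insert j I. z i ^ \<alpha> i / fact (\<alpha> i))
      = (\<Sum>(l, \<alpha>)\<in>(SIGMA l:{..k}. multi_indices I {s. l + s \<in> {k}}).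
          \<Prod>i\<in>insert j I. z i ^ (\<alpha>(j := l)) i / fact ((\<alpha>(j := l)) i))"
    using insert.hyps
    by (subst sum.reindex_bij_betw[symmetric, OF bij_betw_multi_indices_insert[of I j "{k}" k]])
       (auto simp: case_prod_unfold)
  also have "\<dots> = (\<Sum>l\<le>k. \<Sum>\<alpha>\<in>multi_indices I {s. l + s \<in> {k}}.
      \<Prod>i\<in>insert j I. z i ^ (\<alpha>(j := l)) i / fact ((\<alpha>(j := l)) i))"
    using fin by (subst sum.Sigma) auto
  also have "\<dots> = (\<Sum>l\<le>k. z j ^ l / fact l * ((\<Sum>i\<in>I. z i) ^ (k - l) / fact (k - l)))"
  proof (rule sum.cong)
    fix l assume "l \<in> {..k}"
    then have "{s. l + s \<in> {k}} = {k - l}"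
      by auto
    moreover have "(\<Prod>i\<in>insert j I. z i ^ (\<alpha>(j := l)) i / fact ((\<alpha>(j := l)) i))
        = z j ^ l / fact l * (\<Prod>i\<in>I. z i ^ \<alpha> i / fact (\<alpha> i))" for \<alpha>
    proof -
      have "(\<Prod>i\<in>I. z i ^ (\<alpha>(j := l)) i / fact ((\<alpha>(j := l)) i)) = (\<Prod>i\<in>I. z i ^ \<alpha> i / fact (\<alpha> i))"
        using insert.hyps by (intro prod.cong) auto
      then show ?thesis
        using insert.hyps by simp
    qed
    ultimately show "(\<Sum>\<alpha>\<in>multi_indices I {s. l + s \<in> {k}}.
        \<Prod>i\<in>insert j I. z i ^ (\<alpha>(j := l)) i / fact ((\<alpha>(j := l)) i))
      = z j ^ l / fact l * ((\<Sum>i\<in>I. z i) ^ (k - l) / fact (k - l))"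
      by (simp only: insert.IH flip: sum_distrib_left)
  qed simp
  also have "\<dots> = (z j + (\<Sum>i\<in>I. z i)) ^ k / fact k"
    using exp_series_add_commuting[of "z j" "\<Sum>i\<in>I. z i" k]
    by (simp add: divide_inverse_commute)
  finally show ?case
    using insert.hyps by simp
qed

lemma sum_multi_indices_by_degree:
  assumes "finite I" "finite D"
  shows "(\<Sum>\<alpha>\<in>multi_indices I D. h \<alpha>) = (\<Sum>k\<in>D. \<Sum>\<alpha>\<in>multi_indices I {k}. h \<alpha>)"
proof -
  have "finite (multi_indices I D)"
    using assms by (intro finite_multi_indices[where n = "Max D"]) auto
  moreover have "{\<alpha> \<in> multi_indices I D. sum \<alpha> I = k} = multi_indices I {k}" if "k \<in> D" for k
    using that by (auto simp: multi_indices_def)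
  ultimately show ?thesis
    using sum.group[of "multi_indices I D" D "\<lambda>\<alpha>. sum \<alpha> I" h] assms
    by (auto simp: multi_indices_def image_subset_iff)
qed

section \<open>The Gaussian kernel\<close>

text \<open>
  The probability that a Poisson variable with mean \<open>\<mu>\<close> is at least \<open>m\<close> is at most \<open>\<mu>\<^sup>m / m!\<close>: since
  \<open>k! \<ge> m! (k - m)!\<close>, the tail is at most \<open>\<mu>\<^sup>m / m!\<close> times another exponential series.
\<close>
lemma exp_series_tail_le:
  fixes \<mu> :: real
  assumes "0 \<le> \<mu>"
  shows "exp (- \<mu>) * (\<Sum>k\<in>{m..<N}. \<mu> ^ k / fact k) \<le> \<mu> ^ m / fact m"
proof -
  have term_le: "\<mu> ^ k / fact k \<le> \<mu> ^ m / fact m * (\<mu> ^ (k - m) / fact (k - m))" if "k \<in> {m..<N}" for k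
  proof -
    have "fact m * fact (k - m) \<le> (fact k :: nat)"
      using fact_fact_dvd_fact[of m "k - m"] that by (intro dvd_imp_le) auto
    then have "(fact m * fact (k - m) :: real) \<le> fact k"
      by (metis of_nat_fact of_nat_le_iff of_nat_mult)
    then have "\<mu> ^ k / fact k \<le> \<mu> ^ k / (fact m * fact (k - m))"
      using assms by (intro divide_left_mono) auto
    moreover have "\<mu> ^ k = \<mu> ^ m * \<mu> ^ (k - m)"
      using that by (simp flip: power_add)
    ultimately show ?thesis
      by simp
  qed
  have "(\<Sum>k\<in>{m..<N}. \<mu> ^ k / fact k) \<le> (\<Sum>k\<in>{m..<N}. \<mu> ^ m / fact m * (\<mu> ^ (k - m) / fact (k - m)))"
    by (intro sum_mono term_le)
  also have "\<dots> = \<mu> ^ m / fact m * (\<Sum>k\<in>{m..<N}. \<mu> ^ (k - m) / fact (k - m))"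
    by (simp add: sum_distrib_left)
  also have "\<dots> \<le> \<mu> ^ m / fact m * exp \<mu>"
  proof (rule mult_left_mono)
    have "(\<Sum>k\<in>{m..<N}. \<mu> ^ (k - m) / fact (k - m)) = (\<Sum>k<N - m. \<mu> ^ k / fact k)"
      by (rule sum.reindex_bij_witness[where i = "\<lambda>k. k + m" and j = "\<lambda>k. k - m"]) auto
    also have "\<dots> \<le> exp \<mu>"
      using assms sum_le_suminf[OF summable_exp[of \<mu>], of "{..<N - m}"]
      by (simp add: exp_def divide_inverse_commute)
    finally show "(\<Sum>k\<in>{m..<N}. \<mu> ^ (k - m) / fact (k - m)) \<le> exp \<mu>" .
  qed (use assms in simp)
  finally have "(\<Sum>k\<in>{m..<N}. \<mu> ^ k / fact k) \<le> \<mu> ^ m / fact m * exp \<mu>" .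
  then show ?thesis
    using assms by (simp add: exp_minus field_simps)
qed

definition gaussian_feature :: "real \<Rightarrow> ('n::finite \<Rightarrow> nat) \<Rightarrow> real ^ 'n \<Rightarrow> real" where
  "gaussian_feature \<sigma> \<alpha> x = exp (- (\<sigma> * norm x)\<^sup>2) *
     (\<Prod>i\<in>UNIV. sqrt ((2 * \<sigma>\<^sup>2) ^ \<alpha> i / fact (\<alpha> i)) * (x $ i) ^ \<alpha> i)"

lemma sum_gaussian_features_of_degree:
  fixes x y :: "real ^ 'n"
  shows "(\<Sum>\<alpha>\<in>multi_indices UNIV {k}. gaussian_feature \<sigma> \<alpha> x * gaussian_feature \<sigma> \<alpha> y)
    = exp (- (\<sigma> * norm x)\<^sup>2 - (\<sigma> * norm y)\<^sup>2) * ((2 * \<sigma>\<^sup>2 * (x \<bullet> y)) ^ k / fact k)"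
proof -
  have sqrt_sq: "sqrt a * u * (sqrt a * v) = a * (u * v)" if "0 \<le> a" for a u v :: real
    using that by (simp add: algebra_simps flip: real_sqrt_mult)
  have "gaussian_feature \<sigma> \<alpha> x * gaussian_feature \<sigma> \<alpha> y
      = exp (- (\<sigma> * norm x)\<^sup>2 - (\<sigma> * norm y)\<^sup>2) *
        (\<Prod>i\<in>UNIV. (2 * \<sigma>\<^sup>2 * (x $ i * y $ i)) ^ \<alpha> i / fact (\<alpha> i))" for \<alpha>
  proof -
    define u where "u z i = sqrt ((2 * \<sigma>\<^sup>2) ^ \<alpha> i / fact (\<alpha> i)) * (z $ i) ^ \<alpha> i"
      for z :: "real ^ 'n" and i
    have gf: "gaussian_feature \<sigma> \<alpha> z = exp (- (\<sigma> * norm z)\<^sup>2) * (\<Prod>i\<in>UNIV. u z i)" for z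
      by (simp add: gaussian_feature_def u_def)
    have eq: "(\<Prod>i\<in>UNIV. (2 * \<sigma>\<^sup>2 * (x $ i * y $ i)) ^ \<alpha> i / fact (\<alpha> i)) = (\<Prod>i\<in>UNIV. u x i * u y i)"
      unfolding u_def by (intro prod.cong refl, subst sqrt_sq) (simp_all add: power_mult_distrib)
    show ?thesis
      unfolding eq gf prod.distrib by (simp add: exp_diff exp_minus field_simps)
  qed
  then have "(\<Sum>\<alpha>\<in>multi_indices UNIV {k}. gaussian_feature \<sigma> \<alpha> x * gaussian_feature \<sigma> \<alpha> y)
      = exp (- (\<sigma> * norm x)\<^sup>2 - (\<sigma> * norm y)\<^sup>2) * (\<Sum>\<alpha>\<in>multi_indices UNIV {k}.
          \<Prod>i\<in>UNIV. (2 * \<sigma>\<^sup>2 * (x $ i * y $ i)) ^ \<alpha> i / fact (\<alpha> i))"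
    by (simp only: sum_distrib_left)
  also have "\<dots> = exp (- (\<sigma> * norm x)\<^sup>2 - (\<sigma> * norm y)\<^sup>2) *
      ((\<Sum>i\<in>UNIV. 2 * \<sigma>\<^sup>2 * (x $ i * y $ i)) ^ k / fact k)"
    by (simp only: multinomial_exp[OF finite])
  also have "(\<Sum>i\<in>UNIV. 2 * \<sigma>\<^sup>2 * (x $ i * y $ i)) = 2 * \<sigma>\<^sup>2 * (x \<bullet> y)"
    by (simp add: inner_vec_def sum_distrib_left)
  finally show ?thesis .
qed

lemma sum_gaussian_features:
  fixes x y :: "real ^ 'n"
  assumes "finite D"
  shows "(\<Sum>\<alpha>\<in>multi_indices UNIV D. gaussian_feature \<sigma> \<alpha> x * gaussian_feature \<sigma> \<alpha> y)
    = exp (- (\<sigma> * norm x)\<^sup>2 - (\<sigma> * norm y)\<^sup>2) * (\<Sum>k\<in>D. (2 * \<sigma>\<^sup>2 * (x \<bullet> y)) ^ k / fact k)"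
  using assms by (simp add: sum_multi_indices_by_degree sum_gaussian_features_of_degree sum_distrib_left)

lemma gaussian_kernel_feature_expansion:
  fixes x y :: "real ^ 'n"
  shows "(\<lambda>N. \<Sum>\<alpha>\<in>multi_indices UNIV {..<N}. gaussian_feature \<sigma> \<alpha> x * gaussian_feature \<sigma> \<alpha> y)
    \<longlonglongrightarrow> gaussian_kernel \<sigma> x y"
proof -
  have "(\<lambda>N. \<Sum>k<N. (2 * \<sigma>\<^sup>2 * (x \<bullet> y)) ^ k / fact k) \<longlonglongrightarrow> exp (2 * \<sigma>\<^sup>2 * (x \<bullet> y))"
    using exp_converges[of "2 * \<sigma>\<^sup>2 * (x \<bullet> y)"] by (simp add: sums_def divide_inverse_commute)
  then have "(\<lambda>N. \<Sum>\<alpha>\<in>multi_indices UNIV {..<N}. gaussian_feature \<sigma> \<alpha> x * gaussian_feature \<sigma> \<alpha> y)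
      \<longlonglongrightarrow> exp (- (\<sigma> * norm x)\<^sup>2 - (\<sigma> * norm y)\<^sup>2) * exp (2 * \<sigma>\<^sup>2 * (x \<bullet> y))"
    by (simp add: sum_gaussian_features tendsto_mult_left)
  moreover have "exp (- (\<sigma> * norm x)\<^sup>2 - (\<sigma> * norm y)\<^sup>2) * exp (2 * \<sigma>\<^sup>2 * (x \<bullet> y))
      = gaussian_kernel \<sigma> x y"
    unfolding gaussian_kernel_def
    by (simp add: dot_norm_neg power_mult_distrib field_simps flip: exp_add)
  ultimately show ?thesis
    by simp
qed

lemma gaussian_feature_tail_le:
  fixes x :: "real ^ 'n"
  assumes "norm x \<le> 1"
  shows "(\<Sum>\<alpha>\<in>multi_indices UNIV {m..<N}. (gaussian_feature \<sigma> \<alpha> x)\<^sup>2) \<le> (2 * \<sigma>\<^sup>2) ^ m / fact m"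
proof -
  define \<mu> where "\<mu> = 2 * (\<sigma> * norm x)\<^sup>2"
  have "(\<Sum>\<alpha>\<in>multi_indices UNIV {m..<N}. (gaussian_feature \<sigma> \<alpha> x)\<^sup>2)
      = exp (- \<mu>) * (\<Sum>k\<in>{m..<N}. \<mu> ^ k / fact k)"
    using sum_gaussian_features[of "{m..<N}" \<sigma> x x]
    by (simp add: \<mu>_def power2_eq_square dot_square_norm power_mult_distrib mult_ac)
  also have "\<dots> \<le> \<mu> ^ m / fact m"
    by (rule exp_series_tail_le) (simp add: \<mu>_def)
  also have "\<dots> \<le> (2 * \<sigma>\<^sup>2) ^ m / fact m"
  proof (intro divide_right_mono power_mono)
    show "\<mu> \<le> 2 * \<sigma>\<^sup>2"
      using assms by (simp add: \<mu>_def power_mult_distrib mult_left_le power_le_one)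
  qed (auto simp: \<mu>_def)
  finally show ?thesis .
qed

text \<open>
  The squared distance \<open>2 - 2 exp (- \<sigma>\<^sup>2 |x - s|\<^sup>2)\<close> of two kernel sections is at most \<open>2 \<sigma>\<^sup>2 |x - s|\<^sup>2\<close>,
  so a Euclidean net of a compact set is a net for the kernel distance.
\<close>
lemma gaussian_kernel_finite_net:
  fixes X :: "'a::real_normed_vector set"
  assumes "compact X" "0 < \<sigma>" "0 < \<eta>"
  shows "\<exists>S. finite S \<and> S \<subseteq> X \<and> (\<forall>x\<in>X. \<exists>s\<in>S.
    gaussian_kernel \<sigma> x x - 2 * gaussian_kernel \<sigma> x s + gaussian_kernel \<sigma> s s \<le> \<eta>\<^sup>2)"
proof -
  have r: "0 < \<eta> / (2 * \<sigma>)"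
    using assms by simp
  obtain S where S: "finite S" "S \<subseteq> X" "X \<subseteq> (\<Union>s\<in>S. ball s (\<eta> / (2 * \<sigma>)))"
    using seq_compact_imp_totally_bounded[OF compact_imp_seq_compact[OF assms(1)], rule_format, OF r]
    by (elim exE conjE)
  have "\<exists>s\<in>S. gaussian_kernel \<sigma> x x - 2 * gaussian_kernel \<sigma> x s + gaussian_kernel \<sigma> s s \<le> \<eta>\<^sup>2"
    if x: "x \<in> X" for x
  proof -
    obtain s where s: "s \<in> S" "x \<in> ball s (\<eta> / (2 * \<sigma>))"
      using S(3) x by blast
    then have "\<sigma> * norm (x - s) \<le> \<eta> / 2"
      using assms(2) by (simp add: dist_norm norm_minus_commute field_simps)
    then have "(\<sigma> * norm (x - s))\<^sup>2 \<le> (\<eta> / 2)\<^sup>2"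
      using assms(2) by (intro power_mono) auto
    then have "\<sigma>\<^sup>2 * (norm (x - s))\<^sup>2 \<le> \<eta>\<^sup>2 / 4"
      by (simp add: power_mult_distrib power_divide)
    moreover have "1 - \<sigma>\<^sup>2 * (norm (x - s))\<^sup>2 \<le> gaussian_kernel \<sigma> x s"
      using exp_ge_add_one_self[of "- (\<sigma>\<^sup>2 * (norm (x - s))\<^sup>2)"] by (simp add: gaussian_kernel_def)
    moreover have "gaussian_kernel \<sigma> x x = 1" "gaussian_kernel \<sigma> s s = 1"
      by (simp_all add: gaussian_kernel_def)
    ultimately have "gaussian_kernel \<sigma> x x - 2 * gaussian_kernel \<sigma> x s + gaussian_kernel \<sigma> s s \<le> \<eta>\<^sup>2"
      using zero_le_power2[of \<eta>] by linarith
    with s(1) show ?thesis by blast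
  qed
  with S show ?thesis by blast
qed

section \<open>Cutoff degree and Lambert's function\<close>

text \<open>
  \<open>m\<^sup>m / m!\<close> is one term of the exponential series at \<open>m\<close>.
\<close>
lemma power_self_le_exp_fact: "real m ^ m \<le> exp (real m) * fact m"
proof -
  have "real m ^ m / fact m \<le> exp (real m)"
    using sum_le_suminf[OF summable_exp[of "real m"], of "{m}"]
    by (simp add: exp_def divide_inverse_commute)
  then show ?thesis
    by (simp add: field_simps)
qed

lemma mult_exp_strict_mono_on: "strict_mono_on {-1..} (\<lambda>t::real. t * exp t)"
proof (rule strict_mono_onI)
  fix s t :: real assume st: "s \<in> {-1..}" "t \<in> {-1..}" "s < t"
  have "\<exists>z. s < z \<and> z < t \<and> t * exp t - s * exp s = (t - s) * ((1 + z) * exp z)"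
    using st(3) by (intro MVT2) (auto intro!: derivative_eq_intros simp: algebra_simps)
  then show "s * exp s < t * exp t"
    using st by (smt (verit) atLeast_iff exp_gt_zero mult_pos_pos)
qed

lemma lambert_W_mult_exp: "-1 \<le> w \<Longrightarrow> lambert_W (w * exp w) = w"
  unfolding lambert_W_def
  using the_inv_into_f_f[OF strict_mono_on_imp_inj_on[OF mult_exp_strict_mono_on], of w] by simp

lemma mult_exp_surj_pos:
  fixes z :: real
  assumes "z > 0"
  obtains w where "w > 0" "w * exp w = z"
proof -
  have "\<exists>w. 0 \<le> w \<and> w \<le> z \<and> w * exp w = z"
    using assms by (intro IVT') (auto intro!: continuous_intros)
  then show ?thesis
    using assms that by (metis less_eq_real_def mult_zero_left)
qed

lemma gen_binomial_of_nat: "gen_binomial (real n) d = real ((n + d) choose d)"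
  unfolding gen_binomial_eq_gchoose by (metis binomial_gbinomial of_nat_add)

lemma gen_binomial_mono: "0 \<le> s \<Longrightarrow> s \<le> t \<Longrightarrow> gen_binomial s d \<le> gen_binomial t d"
  unfolding gen_binomial_def by (intro mult_left_mono prod_mono) auto

text \<open>
  After distributing \<open>r ^ d\<close>, the factors are \<open>t * r + i * r\<close>; it is therefore enough that \<open>t * r\<close> and \<open>r\<close>
  grow, even if \<open>t\<close> itself does not.
\<close>
lemma gen_binomial_scaled_mono:
  assumes "0 \<le> t" "0 \<le> r" "r \<le> r0" "t * r \<le> t0 * r0"
  shows "gen_binomial t d * r ^ d \<le> gen_binomial t0 d * r0 ^ d"
proof -
  have prod: "gen_binomial s d * q ^ d = (1 / fact d) * (\<Prod>i=1..d. s * q + real i * q)" for s q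
    by (simp add: gen_binomial_def prod.distrib flip: distrib_right)
  show ?thesis
    unfolding prod using assms
    by (intro mult_left_mono prod_mono) (auto intro!: add_mono mult_left_mono)
qed

lemma ln_div_self_antimono:
  fixes x y :: real
  assumes "exp 1 \<le> x" "x \<le> y"
  shows "ln y / y \<le> ln x / x"
proof (rule DERIV_nonpos_imp_nonincreasing[OF assms(2)])
  fix t assume "x \<le> t" "t \<le> y"
  then have t: "exp 1 \<le> t" "0 < t"
    using assms by (auto intro: less_le_trans[OF exp_gt_zero[of "1::real"]])
  then have "1 \<le> ln t"
    by (simp add: ln_ge_iff)
  with t show "\<exists>y. ((\<lambda>t. ln t / t) has_real_derivative y) (at t) \<and> y \<le> 0"
    by (intro exI[of _ "(1 - ln t) / t\<^sup>2"])
       (auto intro!: derivative_eq_intros divide_nonpos_nonneg simp: power2_eq_square)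
qed

text \<open>
  The derivative of \<open>(t + ln t + b + 1) / t\<close> is \<open>- (ln t + b) / t\<^sup>2\<close>.
\<close>
lemma affine_ln_div_antimono:
  fixes v w b :: real
  assumes "0 < v" "v \<le> w" "0 \<le> ln v + b"
  shows "(w + ln w + b + 1) / w \<le> (v + ln v + b + 1) / v"
proof (rule DERIV_nonpos_imp_nonincreasing[OF assms(2)])
  fix t assume "v \<le> t" "t \<le> w"
  then have t: "0 < t" "0 \<le> ln t + b"
    using assms ln_le_cancel_iff[of v t] by (auto intro: order_trans[of 0 "ln v + b"])
  then show "\<exists>y. ((\<lambda>t. (t + ln t + b + 1) / t) has_real_derivative y) (at t) \<and> y \<le> 0"
    by (intro exI[of _ "- (ln t + b) / t\<^sup>2"])
       (auto intro!: derivative_eq_intros divide_nonpos_nonneg simp: power2_eq_square field_simps)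
qed

lemma power_div_fact_le_exp:
  fixes w \<mu> :: real
  assumes "0 < \<mu>" "\<mu> * exp (1 + w) \<le> real m"
  shows "\<mu> ^ m / fact m \<le> exp (- w * real m)"
proof -
  have m: "0 < real m"
    using assms by (smt (verit) exp_gt_zero mult_pos_pos)
  have "\<mu> ^ m / fact m \<le> \<mu> ^ m * (exp (real m) / real m ^ m)"
    using power_self_le_exp_fact[of m] assms(1) m by (auto simp: field_simps)
  also have "\<dots> = (\<mu> * exp 1 / real m) ^ m"
    by (simp add: power_divide power_mult_distrib flip: exp_of_nat_mult)
  also have "\<dots> \<le> exp (- w) ^ m"
    using assms m by (intro power_mono) (auto simp: field_simps exp_add exp_minus)
  finally show ?thesis
    by (simp add: mult.commute flip: exp_of_nat_mult)
qed

text \<open>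
  The cutoff \<open>x\<close> is chosen so that \<open>2 \<sigma>\<^sup>2 e / x = exp (- w)\<close> and \<open>w x = 2 y\<close>.
\<close>
lemma degree_cutoff_bound:
  fixes \<sigma> y w x :: real
  assumes "0 < \<sigma>" "0 < w" and w: "w * exp w = y / (exp 1 * \<sigma>\<^sup>2)" and x: "x = 2 * y / w"
    and m: "x \<le> real m"
  shows "(2 * \<sigma>\<^sup>2) ^ m / fact m \<le> (exp (- y))\<^sup>2"
proof -
  have "2 * \<sigma>\<^sup>2 * exp (1 + w) = x"
    using w assms(1,2) by (simp add: x exp_add field_simps)
  then have "(2 * \<sigma>\<^sup>2) ^ m / fact m \<le> exp (- w * real m)"
    using assms(1,2) m by (intro power_div_fact_le_exp) auto
  also have "\<dots> \<le> exp (- (2 * y))"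
    using assms(2) m by (simp add: x field_simps)
  also have "\<dots> = (exp (- y))\<^sup>2"
    by (simp flip: exp_double)
  finally show ?thesis .
qed

text \<open>
  Taking logarithms of \<open>w exp w = y / (e \<sigma>\<^sup>2)\<close> gives \<open>ln y = w + ln w + ln \<sigma>\<^sup>2 + 1\<close>, so
  \<open>x ln y / y = 2 ln y / w\<close> becomes a function of \<open>w\<close> that decreases where \<open>w \<sigma>\<^sup>2 \<ge> 1\<close>. The lower bound on
  \<open>y\<^sub>0\<close> is the value of \<open>y\<close> for which \<open>w = 1 / \<sigma>\<^sup>2\<close>.
\<close>
lemma growth_factor_antimono:
  fixes \<sigma> :: real
  assumes \<sigma>: "0 < \<sigma>" and y\<^sub>0: "exp (1 + 1 / \<sigma>\<^sup>2) \<le> y\<^sub>0" "y\<^sub>0 \<le> y"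
    and w\<^sub>0: "0 < w\<^sub>0" "w\<^sub>0 * exp w\<^sub>0 = y\<^sub>0 / (exp 1 * \<sigma>\<^sup>2)"
    and w: "0 < w" "w * exp w = y / (exp 1 * \<sigma>\<^sup>2)"
  shows "gen_binomial (2 * y / w) d * (ln y / y) ^ d \<le> gen_binomial (2 * y\<^sub>0 / w\<^sub>0) d * (ln y\<^sub>0 / y\<^sub>0) ^ d"
proof -
  have exp1: "exp 1 \<le> y\<^sub>0"
    using y\<^sub>0(1) by (rule order_trans[rotated]) simp
  then have pos: "0 < y\<^sub>0" "0 < y"
    using y\<^sub>0(2) less_le_trans[OF exp_gt_zero[of "1::real"]] by auto
  have mono: "s \<le> t" if "0 \<le> s" "0 \<le> t" "s * exp s \<le> t * exp t" for s t :: real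
    using that strict_mono_onD[OF mult_exp_strict_mono_on, of t s] by (cases "s \<le> t") auto
  have "1 / \<sigma>\<^sup>2 * exp (1 / \<sigma>\<^sup>2) \<le> w\<^sub>0 * exp w\<^sub>0"
  proof -
    have "1 / \<sigma>\<^sup>2 * exp (1 / \<sigma>\<^sup>2) = exp (1 + 1 / \<sigma>\<^sup>2) / (exp 1 * \<sigma>\<^sup>2)"
      by (simp only: exp_add) simp
    then show ?thesis
      unfolding w\<^sub>0(2) using y\<^sub>0(1) by (metis divide_right_mono exp_ge_zero mult_nonneg_nonneg zero_le_power2)
  qed
  then have "1 / \<sigma>\<^sup>2 \<le> w\<^sub>0"
    by (rule mono[rotated 2]) (use \<sigma> w\<^sub>0(1) in auto)
  then have "ln (1 / \<sigma>\<^sup>2) \<le> ln w\<^sub>0"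
    using \<sigma> w\<^sub>0(1) by (subst ln_le_cancel_iff) auto
  then have ln_w\<^sub>0: "0 \<le> ln w\<^sub>0 + ln (\<sigma>\<^sup>2)"
    using \<sigma> by (simp add: ln_div)
  have "w\<^sub>0 * exp w\<^sub>0 \<le> w * exp w"
    unfolding w\<^sub>0(2) w(2) using \<sigma> y\<^sub>0(2) by (simp add: divide_right_mono)
  then have "w\<^sub>0 \<le> w"
    by (rule mono[rotated 2]) (use w(1) w\<^sub>0(1) in auto)
  then have ratio: "(w + ln w + ln (\<sigma>\<^sup>2) + 1) / w \<le> (w\<^sub>0 + ln w\<^sub>0 + ln (\<sigma>\<^sup>2) + 1) / w\<^sub>0"
    using w\<^sub>0(1) ln_w\<^sub>0 by (intro affine_ln_div_antimono)
  have ln_eq: "ln z = v + ln v + ln (\<sigma>\<^sup>2) + 1" if "0 < v" "v * exp v = z / (exp 1 * \<sigma>\<^sup>2)" for z v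
  proof -
    have "z = v * exp v * (exp 1 * \<sigma>\<^sup>2)"
      using that(2) \<sigma> by (simp add: field_simps)
    then show ?thesis
      using that(1) \<sigma> by (simp add: ln_mult)
  qed
  show ?thesis
  proof (rule gen_binomial_scaled_mono)
    show "2 * y / w * (ln y / y) \<le> 2 * y\<^sub>0 / w\<^sub>0 * (ln y\<^sub>0 / y\<^sub>0)"
    proof -
      have "ln y / w \<le> ln y\<^sub>0 / w\<^sub>0"
        using ratio by (simp only: ln_eq[OF w] ln_eq[OF w\<^sub>0])
      moreover have "2 * y / w * (ln y / y) = 2 * (ln y / w)"
          "2 * y\<^sub>0 / w\<^sub>0 * (ln y\<^sub>0 / y\<^sub>0) = 2 * (ln y\<^sub>0 / w\<^sub>0)"
        using pos by simp_all
      ultimately show ?thesis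
        by linarith
    qed
    show "ln y / y \<le> ln y\<^sub>0 / y\<^sub>0"
      using exp1 y\<^sub>0(2) by (rule ln_div_self_antimono)
    have "1 \<le> y"
      using exp1 y\<^sub>0(2) exp_ge_add_one_self[of "1::real"] by linarith
    then show "0 \<le> ln y / y"
      by simp
  qed (use pos w in auto)
qed

section \<open>The covering number bound\<close>

text \<open>
  The radius \<open>\<epsilon>\<close> is split into \<open>\<tau> = \<epsilon> / 4\<close> and \<open>\<delta> = 2 \<epsilon> / 3\<close>, with \<open>\<epsilon> / 12\<close> to spare. The first is the
  tail of the expansion beyond degree \<open>\<lfloor>x\<rfloor>\<close>; the second gives \<open>1 + 2 / \<delta> = 1 + 3 / \<epsilon> \<le> 4 / \<epsilon>\<close>.
\<close>
lemma gaussian_log_covering_number_le: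
  fixes H :: "((real ^ 'n) \<Rightarrow> real) set"
  assumes rkhs: "rkhs (cball 0 1) (gaussian_kernel \<sigma>) H ip" and \<sigma>: "0 < \<sigma>"
    and \<epsilon>: "0 < \<epsilon>" "\<epsilon> \<le> 1" and y: "y = ln (4 / \<epsilon>)"
    and w: "0 < w" "w * exp w = y / (exp 1 * \<sigma>\<^sup>2)"
  shows "log_covering_number H (ip_norm ip) (ell_infty (cball 0 1)) (sup_norm (cball 0 1)) (\<lambda>f. f) \<epsilon>
    \<le> ereal (gen_binomial (2 * y / w) CARD('n) * y)"
proof -
  interpret rkhs "cball 0 1 :: (real ^ 'n) set" "gaussian_kernel \<sigma>" H ip
    by fact
  define x where "x = 2 * y / w"
  define n where "n = nat \<lfloor>x\<rfloor>"
  \<comment> \<open>\<open>F (Suc n)\<close> holds the degrees up to \<open>n\<close>, so the first omitted degree \<open>Suc n\<close> is at least \<open>x\<close>\<close>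
  define F where "F N = multi_indices (UNIV :: 'n set) {..<N}" for N
  have y_pos: "0 < y"
    using \<epsilon> by (simp add: y)
  have x_pos: "0 < x"
    using y_pos w(1) by (simp add: x_def)
  have n: "real n \<le> x" "x \<le> real (Suc n)"
    using x_pos by (auto simp: n_def) linarith
  have \<tau>: "\<epsilon> / 4 = exp (- y)"
    using \<epsilon> by (simp add: y exp_minus)
  have card_F: "real (card (F (Suc n))) = gen_binomial (real n) CARD('n)"
    by (simp add: F_def lessThan_Suc_atMost card_multi_indices_atMost gen_binomial_of_nat)
  have "log_covering_number H (ip_norm ip) (ell_infty (cball 0 1)) (sup_norm (cball 0 1)) (\<lambda>f. f) \<epsilon>
      \<le> ereal (card (F (Suc n)) * ln (1 + 2 / (2 * \<epsilon> / 3)))"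
  proof (rule log_covering_number_le_by_features[where \<Phi> = "gaussian_feature \<sigma>" and \<tau> = "\<epsilon> / 4"])
    show "finite (F N)" for N
      unfolding F_def by (rule finite_multi_indices[where n = N]) auto
    show "mono F"
      by (auto simp: F_def multi_indices_def mono_def)
    show "(\<Sum>\<alpha>\<in>F N - F (Suc n). (gaussian_feature \<sigma> \<alpha> z)\<^sup>2) \<le> (\<epsilon> / 4)\<^sup>2"
      if "z \<in> cball 0 1" for z :: "real ^ 'n" and N
    proof -
      have "F N - F (Suc n) = multi_indices UNIV {Suc n..<N}"
        by (auto simp: F_def multi_indices_def)
      then have "(\<Sum>\<alpha>\<in>F N - F (Suc n). (gaussian_feature \<sigma> \<alpha> z)\<^sup>2) \<le> (2 * \<sigma>\<^sup>2) ^ Suc n / fact (Suc n)"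
        using that gaussian_feature_tail_le[of z \<sigma> "Suc n" N] by (simp only: mem_cball_0)
      also have "\<dots> \<le> (\<epsilon> / 4)\<^sup>2"
        unfolding \<tau> using degree_cutoff_bound[OF \<sigma> w x_def n(2)] .
      finally show ?thesis .
    qed
    show "\<exists>S. finite S \<and> S \<subseteq> cball 0 1 \<and> (\<forall>x\<in>cball (0 :: real ^ 'n) 1. \<exists>s\<in>S.
        gaussian_kernel \<sigma> x x - 2 * gaussian_kernel \<sigma> x s + gaussian_kernel \<sigma> s s \<le> \<eta>\<^sup>2)"
      if "0 < \<eta>" for \<eta>
      using \<sigma> that by (intro gaussian_kernel_finite_net[OF compact_cball])
  qed (use \<epsilon> gaussian_kernel_feature_expansion in \<open>auto simp: F_def gaussian_kernel_def\<close>)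
  also have "card (F (Suc n)) * ln (1 + 2 / (2 * \<epsilon> / 3)) \<le> gen_binomial x CARD('n) * y"
    unfolding card_F
  proof (intro mult_mono gen_binomial_mono)
    have "1 + 2 / (2 * \<epsilon> / 3) \<le> 4 / \<epsilon>"
      using \<epsilon> by (simp add: field_simps)
    then show "ln (1 + 2 / (2 * \<epsilon> / 3)) \<le> y"
      unfolding y using \<epsilon> by (intro ln_mono) (auto intro: add_pos_pos)
    show "0 \<le> gen_binomial x CARD('n)"
      unfolding gen_binomial_def using x_pos by (intro mult_nonneg_nonneg prod_nonneg) auto
  qed (use n \<epsilon> in auto)
  finally show ?thesis
    by (simp add: x_def)
qed

theorem theorem2p2:
  fixes \<sigma> \<epsilon>\<^sub>0 y\<^sub>0 x\<^sub>0 K :: real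
    and d :: nat
    and B :: "(real ^ 'n) set"
    and H :: "((real ^ 'n) \<Rightarrow> real) set"
    and ip :: "((real ^ 'n) \<Rightarrow> real) \<Rightarrow> ((real ^ 'n) \<Rightarrow> real) \<Rightarrow> real"
  assumes "d = CARD('n)"
    and "B = cball 0 1"
    and "\<sigma> > 0"
    and "0 < \<epsilon>\<^sub>0" and "\<epsilon>\<^sub>0 \<le> 4 * exp (- exp (1 + 1 / \<sigma>\<^sup>2))"
    and "y\<^sub>0 = ln (4 / \<epsilon>\<^sub>0)"
    and "x\<^sub>0 = 2 * y\<^sub>0 / lambert_W (y\<^sub>0 / (exp 1 * \<sigma>\<^sup>2))"
    and "K = gen_binomial x\<^sub>0 d * (ln y\<^sub>0 / y\<^sub>0) ^ d"
    and "rkhs B (gaussian_kernel \<sigma>) H ip"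
  shows "\<forall>\<epsilon>. 0 < \<epsilon> \<and> \<epsilon> \<le> \<epsilon>\<^sub>0 \<longrightarrow>
    log_covering_number H (ip_norm ip) (ell_infty B) (sup_norm B) (\<lambda>f. f) \<epsilon>
      \<le> ereal (K * (ln (4 / \<epsilon>) ^ (d + 1) / ln (ln (4 / \<epsilon>)) ^ d))"
proof (intro allI impI)
  fix \<epsilon> :: real
  assume \<epsilon>: "0 < \<epsilon> \<and> \<epsilon> \<le> \<epsilon>\<^sub>0"
  define y where "y = ln (4 / \<epsilon>)"
  have "ln \<epsilon>\<^sub>0 \<le> ln (4 * exp (- exp (1 + 1 / \<sigma>\<^sup>2)))"
    using assms(4,5) by (subst ln_le_cancel_iff) auto
  then have y\<^sub>0: "exp (1 + 1 / \<sigma>\<^sup>2) \<le> y\<^sub>0"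
    using assms(4) by (simp add: assms(6) ln_mult ln_div)
  have y: "y\<^sub>0 \<le> y"
    using \<epsilon> assms(4) by (simp add: y_def assms(6) ln_div)
  have "2 \<le> exp (1 + 1 / \<sigma>\<^sup>2)"
    using exp_ge_add_one_self[of "1 + 1 / \<sigma>\<^sup>2"] zero_le_divide_1_iff[of "\<sigma>\<^sup>2"]
    zero_le_power2[of \<sigma>] by linarith
  then have y\<^sub>0_ge: "2 \<le> y\<^sub>0"
    using y\<^sub>0 by linarith
  have "\<epsilon> = 4 * exp (- y)"
    using \<epsilon> by (simp add: y_def exp_minus)
  moreover have "exp (- y) \<le> exp (- 2)" "exp (- 2 :: real) \<le> 1 / 4"
    using y y\<^sub>0_ge exp_ge_add_one_self[of "1::real"] power_mono[of 2 "exp (1::real)" 2]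
    by (auto simp: exp_minus field_simps simp flip: exp_of_nat_mult)
  ultimately have \<epsilon>_le: "\<epsilon> \<le> 1"
    by linarith
  obtain w where w: "0 < w" "w * exp w = y / (exp 1 * \<sigma>\<^sup>2)"
    using mult_exp_surj_pos[of "y / (exp 1 * \<sigma>\<^sup>2)"] y y\<^sub>0_ge assms(3) by auto
  obtain w\<^sub>0 where w\<^sub>0: "0 < w\<^sub>0" "w\<^sub>0 * exp w\<^sub>0 = y\<^sub>0 / (exp 1 * \<sigma>\<^sup>2)"
    using mult_exp_surj_pos[of "y\<^sub>0 / (exp 1 * \<sigma>\<^sup>2)"] y\<^sub>0_ge assms(3) by auto
  have K: "K = gen_binomial (2 * y\<^sub>0 / w\<^sub>0) d * (ln y\<^sub>0 / y\<^sub>0) ^ d"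
    using lambert_W_mult_exp[of w\<^sub>0] w\<^sub>0 by (simp add: assms(7,8))
  have "log_covering_number H (ip_norm ip) (ell_infty B) (sup_norm B) (\<lambda>f. f) \<epsilon>
      \<le> ereal (gen_binomial (2 * y / w) d * y)"
    unfolding assms(1,2)
    using assms(2,3,9) \<epsilon> \<epsilon>_le w by (intro gaussian_log_covering_number_le[OF _ _ _ _ y_def]) auto
  also have "gen_binomial (2 * y / w) d * y \<le> K * (y ^ (d + 1) / ln y ^ d)"
  proof -
    have pos: "0 < y" "0 < ln y"
      using y y\<^sub>0_ge by auto
    have "gen_binomial (2 * y / w) d * y
        = gen_binomial (2 * y / w) d * (ln y / y) ^ d * (y ^ (d + 1) / ln y ^ d)"
      using pos by (simp add: power_divide)
    also have "\<dots> \<le> K * (y ^ (d + 1) / ln y ^ d)"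
      unfolding K using growth_factor_antimono[OF assms(3) y\<^sub>0 y w\<^sub>0 w] pos
      by (intro mult_right_mono) auto
    finally show ?thesis .
  qed
  finally show "log_covering_number H (ip_norm ip) (ell_infty B) (sup_norm B) (\<lambda>f. f) \<epsilon>
      \<le> ereal (K * (ln (4 / \<epsilon>) ^ (d + 1) / ln (ln (4 / \<epsilon>)) ^ d))"
    by (simp add: y_def)
qed

end
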